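(* Let $k,\ell\ge0$ be integers, $n=k+\ell+1$, and let $$\Theta_{k,\ell}(q)=\frac{\binom{n+1}{k}_q\binom{n+1}{k+1}_q\binom{n+1}{k+2}_q}{\binom{n+1}{1}_q\binom{n+1}{2}_q}.$$ Then $\Theta_{k,\ell}(q)$ is a polynomial in $q$ with non-negative integer coefficients, its sequence of coefficients is symmetric (palindromic), and its value at $q=-1$ is $$\Theta_{k,\ell}(-1)=\Theta_{k,\ell}^{\circlearrowleft},$$ where $\Theta_{k,\ell}^{\circlearrowleft}$ is the number of Baxter objects of order $(k,\ell)$ fixed under their natural involution, i.e. the number of self-complementary plane partitions in a $k\times\ell\times 3$ box.
   Context: $q$-binomial coefficients: $\binom{N}{i}_q=\frac{[N]!_q}{[i]!_q[N-i]!_q}$, with $[m]!_q=[m]_q[m-1]_q\cdots[1]_q$ and $[j]_q=1+q+\cdots+q^{j-1}$. A plane partition in a $k\times\ell\times3$ box is an array $(\pi_{i,j})_{1\le i\le k,1\le j\le\ell}$ with entries in $\{0,1,2,3\}$, weakly decreasing along rows and columns. Its complement is $\pi'_{i,j}=3-\pi_{k+1-i,\ell+1-j}$; $\pi$ is self-complementary if $\pi'=\pi$. (If $k=0$ or $\ell=0$ there is exactly one plane partition, the empty one, and it is self-complementary.) $\Theta^{\circlearrowleft}_{k,\ell}$ is the common number of fixed points of the natural involutions on seven equinumerous families of "Baxter objects of order $(k,\ell)$" (related by bijections commuting with the involutions); the family of plane partitions in a $k\times\ell\times3$ box with complementation is one of the seven, and is used here as the definition of $\Theta^{\circlearrowleft}_{k,\ell}$.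 A polynomial $\sum_{j=0}^d c_jq^j$ of degree $d$ has symmetric coefficients if $c_j=c_{d-j}$ for all $j$. *)

theory Defs
  imports
    "HOL-Library.FuncSet"
    "HOL-Computational_Algebra.Polynomial_Factorial"
begin

definition q_int :: "nat \<Rightarrow> int poly" where
  "q_int j = (\<Sum>i<j. monom 1 i)"

definition q_fact :: "nat \<Rightarrow> int poly" where
  "q_fact m = (\<Prod>j=1..m. q_int j)"

(* Formed in the fraction field of Z[q], so that the divisions are exact and being a polynomial
   remains a claim; the value 0 for i > N is a convention. *)
definition q_binomial :: "nat \<Rightarrow> nat \<Rightarrow> int poly fract" where
  "q_binomial N i =
     (if i \<le> N then to_fract (q_fact N) / (to_fract (q_fact i) * to_fract (q_fact (N - i))) else 0)"

definition baxter_Theta :: "nat \<Rightarrow> nat \<Rightarrow> int poly fract" where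
  "baxter_Theta k l = (let n = k + l + 1 in
     (q_binomial (n + 1) k * q_binomial (n + 1) (k + 1) * q_binomial (n + 1) (k + 2)) /
     (q_binomial (n + 1) 1 * q_binomial (n + 1) 2))"

definition symmetric_coeffs :: "'a::zero poly \<Rightarrow> bool" where
  "symmetric_coeffs p \<longleftrightarrow> (\<forall>j\<le>degree p. coeff p j = coeff p (degree p - j))"

(* Arrays are functions on index pairs that are undefined outside the k x l rectangle, so that
   equality of functions is equality of arrays and each array is counted once. *)
definition plane_partitions :: "nat \<Rightarrow> nat \<Rightarrow> nat \<Rightarrow> (nat \<times> nat \<Rightarrow> nat) set" where
  "plane_partitions k l m =
     {\<pi> \<in> ({1..k} \<times> {1..l}) \<rightarrow>\<^sub>E {0..m}.
        (\<forall>i\<in>{1..k}. \<forall>j\<in>{1..l}. \<forall>j'\<in>{1..l}. j \<le> j' \<longrightarrow> \<pi> (i, j') \<le> \<pi> (i, j)) \<and>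
        (\<forall>i\<in>{1..k}. \<forall>i'\<in>{1..k}. \<forall>j\<in>{1..l}. i \<le> i' \<longrightarrow> \<pi> (i', j) \<le> \<pi> (i, j))}"

definition pp_complement ::
  "nat \<Rightarrow> nat \<Rightarrow> nat \<Rightarrow> (nat \<times> nat \<Rightarrow> nat) \<Rightarrow> (nat \<times> nat \<Rightarrow> nat)" where
  "pp_complement k l m \<pi> =
     (\<lambda>(i, j)\<in>{1..k} \<times> {1..l}. m - \<pi> (k + 1 - i, l + 1 - j))"

definition baxter_Theta_fixed :: "nat \<Rightarrow> nat \<Rightarrow> nat" where
  "baxter_Theta_fixed k l = card {\<pi> \<in> plane_partitions k l 3. pp_complement k l 3 \<pi> = \<pi>}"

end

theory Submission
  imports Defs
begin

text \<open>
  A plane partition in a \<open>k \<times> l \<times> 3\<close> box is a stack of three nested Young diagrams, and each diagram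
  is given by its boundary, a lattice path of \<open>k + l\<close> steps of which \<open>k\<close> go up. So plane partitions
  correspond to triples of nested lattice paths. Let \<open>P n a b c\<close> be the weighted count of nested
  triples of \<open>n\<close>-step paths with final heights \<open>a \<ge> b \<ge> c\<close> (\<open>path_sum\<close>), where the \<open>n\<close>-th step of
  a path has weight \<open>q\<close> to the power \<open>n\<close> minus its new height if it goes up. It satisfies an
  eight-term recurrence, one term for each choice of last steps. The same recurrence holds for a
  product of \<open>q\<close>-factorials times a Vandermonde product (\<open>closed_form_recurrence\<close>); the Vandermonde
  factor vanishes at the end points outside the nested region that one step can reach from inside
  it, so no boundary terms remain, and the two agree (\<open>path_sum_eq_closed_form\<close>). For the end point
  \<open>(k, k, k)\<close> after \<open>k + l\<close> steps the product is \<open>\<Theta>\<^sub>k\<^sub>,\<^sub>l(q)\<close>. Hence \<open>\<Theta>\<close> is a polynomial, and it has non-negative coefficients because the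
  recurrence has. It is palindromic because every \<open>q\<close>-factorial is.

  For the value at \<open>-1\<close>, the \<open>q\<close>-factorial of \<open>m\<close> is divisible by \<open>1 + q\<close> to the power \<open>m div 2\<close>,
  with a cofactor whose value at \<open>-1\<close> is \<open>(m div 2)!\<close>. Cancelling these powers in the product
  formula gives \<open>\<Theta>(-1)\<close> as a quotient of ordinary factorials (\<open>theta_poly_at_minus_1\<close>), or 0 if
  \<open>k\<close> and \<open>l\<close> are both odd.

  Complementing a plane partition reverses the three paths and exchanges the outer two. A
  self-complementary plane partition is therefore determined by the first halves of its paths, and
  any nested triple of half paths occurs whose end point \<open>(x, y, z)\<close> can be joined to its mirror
  image: \<open>x + z = k\<close> and \<open>2 y = k\<close>, up to a middle step if \<open>k + l\<close> is odd
  (\<open>inj_on_half_boundaries\<close>, \<open>half_boundaries_surj\<close>). Their number is the sum of the product formula at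
  \<open>q = 1\<close> over these end points. The end points form one or two one-parameter families, and the
  sums over them telescope (\<open>sum_ifact_cubes\<close>, \<open>sum_ifact_half_cubes\<close>); the totals are the quotients of
  factorials found for \<open>\<Theta>(-1)\<close>.
\<close>

section \<open>Triples of lattice paths: weighted recurrence and product formula\<close>

text \<open>The weighted count of nested triples of lattice paths with \<open>n\<close> steps that start at height 0 and
end at heights \<open>a \<ge> b \<ge> c\<close>. The \<open>i\<close>-th up step of a path, if it is taken at time \<open>t\<close>, has weight
\<open>q ^ (t - i)\<close>, so the exponent of \<open>q\<close> adds up the areas beside the three paths. Heights are integers
so that the recurrence can step outside the region where the count is non-zero.\<close>

fun path_sum :: "'a::comm_semiring_1 \<Rightarrow> nat \<Rightarrow> int \<Rightarrow> int \<Rightarrow> int \<Rightarrow> 'a" where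
  "path_sum q 0 a b c = (if a = 0 \<and> b = 0 \<and> c = 0 then 1 else 0)"
| "path_sum q (Suc n) a b c = (if c \<le> b \<and> b \<le> a then
     (\<Sum>(e, f, g)\<in>{0, 1} \<times> {0, 1} \<times> {0, 1}.
        q ^ nat (e * (int n + 1 - a) + f * (int n + 1 - b) + g * (int n + 1 - c)) *
        path_sum q n (a - e) (b - f) (c - g)) else 0)"

lemma sum_cube:
  fixes h :: "int \<Rightarrow> int \<Rightarrow> int \<Rightarrow> 'a::comm_monoid_add"
  shows "(\<Sum>(e, f, g)\<in>{0, 1} \<times> {0, 1} \<times> {0, 1}. h e f g) =
    h 0 0 0 + h 1 0 0 + h 0 1 0 + h 0 0 1 + h 0 1 1 + h 1 0 1 + h 1 1 0 + h 1 1 1"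
proof -
  have "{0, 1} \<times> {0, 1} \<times> {0, 1} = {(0, 0, 0), (1, 0, 0), (0, 1, 0), (0, 0, 1), (0, 1, 1),
    (1, 0, 1), (1, 1, 0), (1, 1, 1 :: int) :: int \<times> int \<times> int}"
    by auto
  then show ?thesis by (simp add: add_ac)
qed

text \<open>This is a \<open>3 \<times> 3\<close> determinant evaluation. The function \<open>d\<close> is the Vandermonde determinant with rows
\<open>(u\<^sup>2, u, 1)\<close>, so by multilinearity the left-hand side is the determinant whose row for \<open>u\<close> results
from applying \<open>p \<mapsto> (w - u) p(u) + X(w) u p(s(u))\<close> to the polynomials \<open>u\<^sup>2, u, 1\<close>. This operator is
triangular up to the common factor \<open>X(u)\<close>, which leaves a Vandermonde determinant times the
diagonal entries \<open>w\<close>, \<open>s(w)\<close>, \<open>s(s(w))\<close>.\<close>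

lemma vandermonde_shift_identity:
  fixes x y z w q r :: "'a::idom"
  assumes "q * r = 1"
    and d_def: "\<And>x y z. d x y z = (x - y) * (x - z) * (y - z)"
    and s_def: "\<And>x. s x = r * (x - 1)"
    and X_def: "\<And>x. X x = 1 + (q - 1) * x"
  shows "(w - x) * (w - y) * (w - z) * d x y z
       + X w * x * (w - y) * (w - z) * d (s x) y z
       + (w - x) * (X w * y) * (w - z) * d x (s y) z
       + (w - x) * (w - y) * (X w * z) * d x y (s z)
       + (w - x) * (X w * y) * (X w * z) * d x (s y) (s z)
       + (X w * x) * (w - y) * (X w * z) * d (s x) y (s z)
       + (X w * x) * (X w * y) * (w - z) * d (s x) (s y) z
       + (X w * x) * (X w * y) * (X w * z) * d (s x) (s y) (s z)
       = w * s w * s (s w) * X x * X y * X z * d x y z" (is "?L = _")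
proof -
  define P0 where "P0 = (\<lambda>u. (w - u) + X w * u)"
  define P1 where "P1 = (\<lambda>u. (w - u) * u + X w * u * s u)"
  define P2 where "P2 = (\<lambda>u. (w - u) * u\<^sup>2 + X w * u * (s u)\<^sup>2)"
  \<comment> \<open>The off-diagonal entry of the triangular operator, which drops out of the determinant.\<close>
  define c where "c = r * ((1 - r) * w + r)"
  have P0: "P0 u = w * X u" for u
    by (simp add: P0_def X_def algebra_simps)
  have P1: "P1 u = s w * X u * u" for u
    unfolding P1_def X_def s_def using assms(1) by algebra
  have P2: "P2 u = X u * (s (s w) * u\<^sup>2 + c * u)" for u
    unfolding P2_def X_def s_def c_def using assms(1) by algebra
  have "?L = P2 x * (P1 y * P0 z - P0 y * P1 z) - P1 x * (P2 y * P0 z - P0 y * P2 z)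
      + P0 x * (P2 y * P1 z - P1 y * P2 z)"
    unfolding d_def P0_def P1_def P2_def by algebra
  also have "\<dots> = w * s w * s (s w) * X x * X y * X z * d x y z"
    unfolding P0 P1 P2 d_def by algebra
  finally show ?thesis .
qed

text \<open>The bracket \<open>br z\<close> is the \<open>q\<close>-analogue of the integer \<open>z\<close>. Characterising it by its addition law,
rather than as \<open>(q\<^sup>z - 1) / (q - 1)\<close>, allows \<open>q = 1\<close>, so that one computation covers both
the polynomial \<open>\<Theta>\<close> and the plain count of paths.\<close>

locale q_numbers =
  fixes q :: "'a::field" and br :: "int \<Rightarrow> 'a"
  assumes q_nonzero: "q \<noteq> 0"
    and br_add: "br (x + y) = br x + q powi x * br y"
    and br_1: "br 1 = 1"
    and br_pos_nonzero: "0 < x \<Longrightarrow> br x \<noteq> 0"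
begin

definition qfact :: "nat \<Rightarrow> 'a" where "qfact n = (\<Prod>j=1..n. br (int j))"

text \<open>The inverse \<open>q\<close>-factorial, extended by 0 to negative integers. With this convention the law
\<open>ifact_minus_1\<close> holds for all integers, and product formulas need no case distinction where they
vanish.\<close>

definition ifact :: "int \<Rightarrow> 'a" where
  "ifact z = (if z < 0 then 0 else inverse (qfact (nat z)))"

definition closed_form :: "nat \<Rightarrow> int \<Rightarrow> int \<Rightarrow> int \<Rightarrow> 'a" where
  "closed_form n a b c =
     br (a - b + 1) * br (a - c + 2) * br (b - c + 1) *
     (qfact n * qfact (n + 1) * qfact (n + 2)) *
     (ifact (a + 2) * ifact (int n - a)) *
     (ifact (b + 1) * ifact (int n + 1 - b)) *
     (ifact c * ifact (int n + 2 - c))"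

lemma br_0: "br 0 = 0"
  using br_add[of 1 0] q_nonzero by simp

lemma powi_br: "q powi x = 1 + (q - 1) * br x"
  using br_add[of x 1] br_add[of 1 x] by (simp add: br_1 add.commute algebra_simps)

lemma br_minus_1: "br (x - 1) = (br x - 1) / q"
  using br_add[of 1 "x - 1"] q_nonzero by (simp add: br_1 field_simps)

lemma br_diff: "br (x - y) = (br x - br y) / q powi y"
  using br_add[of y "x - y"] q_nonzero by (simp add: field_simps)

lemma qfact_Suc: "qfact (Suc n) = br (int n + 1) * qfact n"
  by (simp add: qfact_def prod.nat_ivl_Suc' add.commute mult.commute)

lemma ifact_minus_1: "ifact (z - 1) = br z * ifact z"
proof -
  consider "z < 0" | "z = 0" | n where "z = int (Suc n)"
    by (metis linorder_neqE_linordered_idom gr0_implies_Suc of_nat_0_less_iff pos_int_cases)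
  then show ?thesis
  proof cases
    case (3 n)
    then have "ifact (z - 1) = inverse (qfact n)"
      "ifact z = inverse (br (int n + 1) * qfact n)" "z = int n + 1"
      using qfact_Suc[of n] unfolding ifact_def by (simp_all add: nat_add_distrib)
    then show ?thesis
      using br_pos_nonzero[of "int n + 1"] by simp
  qed (auto simp: ifact_def br_0)
qed

lemma ifact_shift:
  assumes "e \<in> {0, 1}"
  shows "ifact (x - e) * ifact (m - 1 - (x - e)) =
    (if e = 0 then br (m - x) else br x) * (ifact x * ifact (m - x))"
  using assms ifact_minus_1[of "m - x"] ifact_minus_1[of x] by (auto simp: algebra_simps)

text \<open>Each of the eight terms differs from a common product of inverse factorials only by brackets and
powers of \<open>q\<close>. In the variables \<open>x = br (a + 2)\<close>, \<open>y = br (b + 1)\<close>, \<open>z = br c\<close> and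
\<open>w = br (n + 3)\<close>, lowering a height by one becomes the affine map \<open>s\<close>, and
what remains is \<open>vandermonde_shift_identity\<close>.\<close>

lemma closed_form_recurrence:
  "closed_form (Suc n) a b c =
     (\<Sum>(e, f, g)\<in>{0, 1} \<times> {0, 1} \<times> {0, 1}.
        q powi (e * (int n + 1 - a) + f * (int n + 1 - b) + g * (int n + 1 - c)) *
        closed_form n (a - e) (b - f) (c - g))"
proof -
  \<comment> \<open>With respect to \<open>N\<close> the three columns look alike: the factors of the closed form at \<open>n + 1\<close>
are \<open>1 / (i! (N - i)!)\<close> for \<open>i = a + 2, b + 1, c\<close>.\<close>
  define N where "N = int n + 3"
  define X where "X = (\<lambda>x. 1 + (q - 1) * x)"
  define s where "s = (\<lambda>x. inverse q * (x - 1))"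
  define d where "d = (\<lambda>x y z :: 'a. (x - y) * (x - z) * (y - z))"
  define w where "w = br N"
  define x where "x = br (a + 2)"
  define y where "y = br (b + 1)"
  define z where "z = br c"
  define J where "J = qfact n * qfact (n + 1) * qfact (n + 2) *
    (ifact (a + 2) * ifact (N - (a + 2))) * (ifact (b + 1) * ifact (N - (b + 1))) *
    (ifact c * ifact (N - c))"
  define K where "K = J / (X x * X y ^ 2 * X z ^ 3)"
  have powi: "q powi i = X (br i)" for i by (simp add: X_def powi_br)
  have X_nz: "X (br i) \<noteq> 0" for i using q_nonzero by (simp flip: powi)
  have s_br: "s (br i) = br (i - 1)" for i by (simp add: s_def br_minus_1 field_simps)
  have diff: "br (i - j) = (br i - br j) / X (br j)" for i j by (simp add: br_diff powi)
  have nz: "X w \<noteq> 0" "X x \<noteq> 0" "X y \<noteq> 0" "X z \<noteq> 0"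
    by (simp_all add: w_def x_def y_def z_def X_nz)
  have wt: "q powi (N - i) = X w / X (br i)" for i
    using q_nonzero unfolding w_def powi[symmetric] by (simp add: power_int_diff)
  have summand:
    "q powi (e * (int n + 1 - a) + f * (int n + 1 - b) + g * (int n + 1 - c)) *
       closed_form n (a - e) (b - f) (c - g) =
     K * ((if e = 0 then w - x else X w * x) * (if f = 0 then w - y else X w * y) *
          (if g = 0 then w - z else X w * z) *
          d (if e = 0 then x else s x) (if f = 0 then y else s y) (if g = 0 then z else s z))"
    if e: "e \<in> {0, 1}" and f: "f \<in> {0, 1}" and g: "g \<in> {0, 1}" for e f g
  proof -
    have sx: "(if e = 0 then x else s x) = br (a + 2 - e)" using e by (auto simp: x_def s_br)
    have sy: "(if f = 0 then y else s y) = br (b + 1 - f)" using f by (auto simp: y_def s_br)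
    have sz: "(if g = 0 then z else s z) = br (c - g)" using g by (auto simp: z_def s_br)
    have Xsy: "X (br (b + 1 - f)) = X y / q powi f"
      using q_nonzero unfolding y_def powi[symmetric] by (simp add: power_int_diff)
    have Xsz: "X (br (c - g)) = X z / q powi g"
      using q_nonzero unfolding z_def powi[symmetric] by (simp add: power_int_diff)
    have V: "br (a - e - (b - f) + 1) * br (a - e - (c - g) + 2) * br (b - f - (c - g) + 1) =
        q powi f * q powi (2 * g) / (X y * X z ^ 2) *
        d (br (a + 2 - e)) (br (b + 1 - f)) (br (c - g))"
    proof -
      have v1: "br (a - e - (b - f) + 1) = (br (a + 2 - e) - br (b + 1 - f)) / X (br (b + 1 - f))"
        using diff[of "a + 2 - e" "b + 1 - f"] by (simp add: algebra_simps)
      have v2: "br (a - e - (c - g) + 2) = (br (a + 2 - e) - br (c - g)) / X (br (c - g))"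
        using diff[of "a + 2 - e" "c - g"] by (simp add: algebra_simps)
      have v3: "br (b - f - (c - g) + 1) = (br (b + 1 - f) - br (c - g)) / X (br (c - g))"
        using diff[of "b + 1 - f" "c - g"] by (simp add: algebra_simps)
      have q2: "q powi (2 * g) = q powi g * q powi g"
        using power_int_add[of q g g] q_nonzero unfolding mult_2 by blast
      show ?thesis
        unfolding v1 v2 v3 q2 d_def Xsy Xsz by (simp add: power2_eq_square mult_ac)
    qed
    have row: "q powi (e * (N - x')) * (ifact (x' - e) * ifact (N - 1 - (x' - e))) =
        (if e = 0 then w - br x' else X w * br x') / X (br x') * (ifact x' * ifact (N - x'))"
      if "e \<in> {0, 1}" for e x'
      using that ifact_shift[of e x' N] by (auto simp: wt diff[of N] w_def)
    \<comment> \<open>The extra powers \<open>f + 2 g\<close> come from the Vandermonde factor and make up for the different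
offsets of \<open>a\<close>, \<open>b\<close> and \<open>c\<close> in the weights.\<close>
    have exps: "q powi (e * (int n + 1 - a) + f * (int n + 1 - b) + g * (int n + 1 - c)) *
        (q powi f * q powi (2 * g)) =
        q powi (e * (N - (a + 2))) * q powi (f * (N - (b + 1))) * q powi (g * (N - c))"
    proof -
      have "e * (int n + 1 - a) + f * (int n + 1 - b) + g * (int n + 1 - c) + (f + 2 * g) =
          e * (N - (a + 2)) + f * (N - (b + 1)) + g * (N - c)"
        by (simp add: N_def algebra_simps)
      then show ?thesis
        using q_nonzero by (metis power_int_add)
    qed
    have "q powi (e * (int n + 1 - a) + f * (int n + 1 - b) + g * (int n + 1 - c)) *
       closed_form n (a - e) (b - f) (c - g) =
      (q powi (e * (int n + 1 - a) + f * (int n + 1 - b) + g * (int n + 1 - c)) *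
        (q powi f * q powi (2 * g))) / (X y * X z ^ 2) *
        d (br (a + 2 - e)) (br (b + 1 - f)) (br (c - g)) *
        (qfact n * qfact (n + 1) * qfact (n + 2)) *
        (ifact (a + 2 - e) * ifact (N - 1 - (a + 2 - e))) *
        (ifact (b + 1 - f) * ifact (N - 1 - (b + 1 - f))) *
        (ifact (c - g) * ifact (N - 1 - (c - g)))"
      unfolding closed_form_def V by (simp add: N_def algebra_simps)
    also have "\<dots> = (qfact n * qfact (n + 1) * qfact (n + 2)) / (X y * X z ^ 2) *
        d (br (a + 2 - e)) (br (b + 1 - f)) (br (c - g)) *
        (q powi (e * (N - (a + 2))) * (ifact (a + 2 - e) * ifact (N - 1 - (a + 2 - e)))) *
        (q powi (f * (N - (b + 1))) * (ifact (b + 1 - f) * ifact (N - 1 - (b + 1 - f)))) *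
        (q powi (g * (N - c)) * (ifact (c - g) * ifact (N - 1 - (c - g))))"
      unfolding exps by (simp only: mult_ac times_divide_eq_left times_divide_eq_right)
    also have "\<dots> = K * ((if e = 0 then w - x else X w * x) * (if f = 0 then w - y else X w * y) *
          (if g = 0 then w - z else X w * z) * d (br (a + 2 - e)) (br (b + 1 - f)) (br (c - g)))"
      unfolding row[OF e] row[OF f] row[OF g] K_def J_def
      by (simp only: x_def y_def z_def) (simp add: power2_eq_square power3_eq_cube mult_ac split del: if_split)
    finally show ?thesis unfolding sx sy sz .
  qed
  have "closed_form (Suc n) a b c = K * (w * s w * s (s w) * X x * X y * X z * d x y z)"
  proof -
    have v: "br (a - b + 1) = (x - y) / X y" "br (a - c + 2) = (x - z) / X z"
      "br (b - c + 1) = (y - z) / X z"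
      using diff[of "a + 2" "b + 1"] diff[of "a + 2" c] diff[of "b + 1" c]
      by (simp_all add: x_def y_def z_def algebra_simps)
    have s: "w = br (int n + 3)" "s w = br (int n + 2)" "s (s w) = br (int n + 1)"
      by (simp_all add: w_def N_def s_br add.commute)
    have f: "qfact (Suc n) = br (int n + 1) * qfact n"
      "qfact (Suc n + 1) = br (int n + 2) * qfact (n + 1)"
      "qfact (Suc n + 2) = br (int n + 3) * qfact (n + 2)"
      using qfact_Suc[of n] qfact_Suc[of "n + 1"] qfact_Suc[of "n + 2"]
      by (simp_all add: algebra_simps)
    have N: "int (Suc n) - a = N - (a + 2)" "int (Suc n) + 1 - b = N - (b + 1)"
      "int (Suc n) + 2 - c = N - c"
      by (simp_all add: N_def)
    show ?thesis
      unfolding closed_form_def v f N s[symmetric] K_def J_def d_def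
      using nz by (simp add: power2_eq_square power3_eq_cube mult_ac)
  qed
  also have "w * s w * s (s w) * X x * X y * X z * d x y z =
    (\<Sum>(e, f, g)\<in>{0, 1::int} \<times> {0, 1::int} \<times> {0, 1::int}.
      (if e = 0 then w - x else X w * x) * (if f = 0 then w - y else X w * y) *
          (if g = 0 then w - z else X w * z) *
          d (if e = 0 then x else s x) (if f = 0 then y else s y) (if g = 0 then z else s z))"
    using vandermonde_shift_identity[of q "inverse q" d s X w x y z] q_nonzero
    unfolding sum_cube by (simp add: X_def s_def d_def)
  also have "K * \<dots> = (\<Sum>(e, f, g)\<in>{0, 1} \<times> {0, 1} \<times> {0, 1}.
        q powi (e * (int n + 1 - a) + f * (int n + 1 - b) + g * (int n + 1 - c)) *
        closed_form n (a - e) (b - f) (c - g))"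
    unfolding sum_distrib_left by (intro sum.cong refl) (clarsimp simp only: summand mem_Times_iff fst_conv snd_conv prod.case)
  finally show ?thesis .
qed

lemma closed_form_eq_0:
  "c < 0 \<or> int n < a \<or> a = b - 1 \<or> b = c - 1 \<Longrightarrow> c \<le> b + 1 \<Longrightarrow> b \<le> a + 1 \<Longrightarrow> closed_form n a b c = 0"
  unfolding closed_form_def by (auto simp: ifact_def br_0)

text \<open>Lowering a single height of a nested triple can violate the nesting only by making two shifted
heights coincide, and there the Vandermonde factor of the closed form is 0, as is the path sum.\<close>

lemma path_sum_eq_closed_form:
  "c \<le> b \<Longrightarrow> b \<le> a \<Longrightarrow> path_sum q n a b c = closed_form n a b c"
proof (induction n arbitrary: a b c)
  case 0
  show ?case
  proof (cases "a = 0 \<and> c = 0")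
    case True
    then show ?thesis
      using 0 br_pos_nonzero[of 2]
      by (auto simp: closed_form_def ifact_def qfact_def br_1 numeral_2_eq_2 field_simps)
  next
    case False
    then have "c < 0 \<or> 0 < a"
      using 0 by auto
    then show ?thesis
      using 0 False closed_form_eq_0[of c 0 a b] by auto
  qed
next
  case (Suc n)
  have IH: "path_sum q n (a - e) (b - f) (c - g) = closed_form n (a - e) (b - f) (c - g)"
    if "e \<in> {0, 1}" "f \<in> {0, 1}" "g \<in> {0, 1}" for e f g
  proof (cases "c - g \<le> b - f \<and> b - f \<le> a - e")
    case True
    then show ?thesis by (intro Suc.IH) auto
  next
    case False
    then have "path_sum q n (a - e) (b - f) (c - g) = 0"
      using Suc.prems that by (cases n) auto
    moreover have "closed_form n (a - e) (b - f) (c - g) = 0"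
      using False Suc.prems that by (intro closed_form_eq_0) auto
    ultimately show ?thesis by simp
  qed
  show ?case
  proof (cases "a \<le> int n + 1")
    case True
    then have wt: "q ^ nat (e * (int n + 1 - a) + f * (int n + 1 - b) + g * (int n + 1 - c)) =
        q powi (e * (int n + 1 - a) + f * (int n + 1 - b) + g * (int n + 1 - c))"
      if "e \<in> {0, 1}" "f \<in> {0, 1}" "g \<in> {0, 1}" for e f g
      using that Suc.prems by (subst power_int_def) auto
    have "path_sum q (Suc n) a b c = (\<Sum>(e, f, g)\<in>{0, 1} \<times> {0, 1} \<times> {0, 1}.
        q ^ nat (e * (int n + 1 - a) + f * (int n + 1 - b) + g * (int n + 1 - c)) *
        path_sum q n (a - e) (b - f) (c - g))"
      using Suc.prems by simp
    also have "\<dots> = closed_form (Suc n) a b c"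
      unfolding closed_form_recurrence
      by (intro sum.cong refl) (clarsimp simp only: wt IH mem_Times_iff fst_conv snd_conv prod.case)
    finally show ?thesis .
  next
    case False
    then have "closed_form n (a - e) (b - f) (c - g) = 0"
      if "e \<in> {0, 1}" "f \<in> {0, 1}" "g \<in> {0, 1}" for e f g
      using that Suc.prems by (intro closed_form_eq_0) auto
    moreover have "closed_form (Suc n) a b c = 0"
      using False Suc.prems by (intro closed_form_eq_0) auto
    moreover have "path_sum q (Suc n) a b c = (\<Sum>(e, f, g)\<in>{0, 1} \<times> {0, 1} \<times> {0, 1}.
        q ^ nat (e * (int n + 1 - a) + f * (int n + 1 - b) + g * (int n + 1 - c)) *
        path_sum q n (a - e) (b - f) (c - g))"
      using Suc.prems by simp
    moreover have "\<dots> = 0"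
      using calculation(1)
      by (intro sum.neutral) (clarsimp simp only: IH mem_Times_iff fst_conv snd_conv prod.case mult_zero_right)
    ultimately show ?thesis by simp
  qed
qed
end

section \<open>The polynomial Theta: product formula, non-negativity and symmetry\<close>

abbreviation X :: "int poly" where "X \<equiv> monom 1 1"

lemma q_int_eq: "(X - 1) * q_int j = X ^ j - 1"
proof -
  have "q_int j = (\<Sum>i<j. X ^ i)"
    by (simp add: q_int_def monom_power)
  then show ?thesis by (simp only: power_diff_1_eq)
qed

lemma q_int_nonzero: "0 < j \<Longrightarrow> q_int j \<noteq> 0"
proof
  assume "0 < j" "q_int j = 0"
  then have "coeff (X ^ j - 1 :: int poly) j = 0"
    using q_int_eq[of j] by simp
  then show False using \<open>0 < j\<close> by (simp add: monom_power)
qed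

lemma to_fract_power: "to_fract (p ^ n) = to_fract p ^ n"
  by (induction n) auto

lemma to_fract_prod: "to_fract (prod f A) = (\<Prod>x\<in>A. to_fract (f x))"
  by (induction A rule: infinite_finite_induct) auto

definition X_fract :: "int poly fract" where "X_fract = to_fract X"

definition q_bracket :: "int \<Rightarrow> int poly fract" where
  "q_bracket z = (X_fract powi z - 1) / (X_fract - 1)"

lemma X_fract_neq: "X_fract \<noteq> 0" "X_fract \<noteq> 1"
proof -
  have "X \<noteq> 0" "X \<noteq> 1" by (auto simp: monom_eq_1_iff)
  then show "X_fract \<noteq> 0" "X_fract \<noteq> 1"
    unfolding X_fract_def by (metis to_fract_eq_0_iff, metis to_fract_1 to_fract_eq_iff)
qed

lemma q_bracket_of_nat: "q_bracket (int j) = to_fract (q_int j)"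
proof -
  have "(X_fract - 1) * to_fract (q_int j) = X_fract ^ j - 1"
    using arg_cong[OF q_int_eq[of j], of to_fract]
    by (simp add: X_fract_def to_fract_power)
  then show ?thesis
    using X_fract_neq by (simp add: q_bracket_def field_simps)
qed

interpretation generic: q_numbers X_fract q_bracket
proof
  show "q_bracket x \<noteq> 0" if "0 < x" for x
    using that q_bracket_of_nat[of "nat x"] q_int_nonzero[of "nat x"] by simp
qed (use X_fract_neq in
  \<open>auto simp: q_bracket_def power_int_add diff_divide_distrib algebra_simps\<close>)

interpretation at_one: q_numbers "1 :: rat" of_int
  by standard auto

lemma qfact_generic: "generic.qfact n = to_fract (q_fact n)"
  unfolding generic.qfact_def q_fact_def by (simp add: to_fract_prod q_bracket_of_nat)

lemma qfact_at_one: "at_one.qfact n = fact n"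
  unfolding at_one.qfact_def by (simp add: fact_prod)

lemma q_fact_nonzero: "q_fact n \<noteq> 0"
  unfolding q_fact_def by (auto simp: q_int_nonzero)

lemma to_fract_path_sum: "to_fract (path_sum q n a b c) = path_sum (to_fract q) n a b c"
  by (induction n arbitrary: a b c)
    (auto simp: to_fract_power split_def simp del: sum.insert intro!: sum.cong)

lemma of_int_path_sum: "of_int (path_sum 1 n a b c) = (path_sum 1 n a b c :: 'a::comm_ring_1)"
  by (induction n arbitrary: a b c) (auto simp: split_def simp del: sum.insert intro!: sum.cong)

lemma path_sum_coeff_nonneg: "0 \<le> coeff (path_sum X n a b c) j"
proof (induction n arbitrary: a b c j)
  case (Suc n)
  have "0 \<le> coeff (X ^ m * path_sum X n a' b' c') j" for m a' b' c'
    using Suc by (auto simp: monom_power coeff_monom_mult)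
  then show ?case
    by (auto simp: coeff_sum split_def simp del: sum.insert intro!: sum_nonneg)
qed auto

definition theta_poly :: "nat \<Rightarrow> nat \<Rightarrow> int poly" where
  "theta_poly k l = path_sum X (k + l) (int k) (int k) (int k)"

lemma q_fact_simps: "q_fact (Suc 0) = 1" "q_fact 2 = q_int 2"
  by (simp_all add: q_fact_def q_int_def numeral_2_eq_2)

text \<open>The product formula without denominators. Being an identity in \<open>\<int>[q]\<close>, it can be reflected and
evaluated at \<open>-1\<close>.\<close>

lemma theta_poly_mult:
  "theta_poly k l * (q_fact k * q_fact (k + 1) * q_fact (k + 2) *
     q_fact l * q_fact (l + 1) * q_fact (l + 2)) =
   q_int 2 * q_fact (k + l) * q_fact (k + l + 1) * q_fact (k + l + 2)"
proof -
  have nat: "nat (int k + 2) = k + 2" "nat (int k + 1) = k + 1"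
    "nat (int l + 2) = l + 2" "nat (int l + 1) = l + 1"
    by (simp_all add: nat_add_distrib)
  have "to_fract (theta_poly k l) = generic.closed_form (k + l) (int k) (int k) (int k)"
    unfolding theta_poly_def to_fract_path_sum X_fract_def[symmetric]
    by (rule generic.path_sum_eq_closed_form) simp_all
  also have "\<dots> = to_fract (q_int 2) * to_fract (q_fact (k + l)) *
      to_fract (q_fact (k + l + 1)) * to_fract (q_fact (k + l + 2)) /
      (to_fract (q_fact k) * to_fract (q_fact (k + 1)) * to_fract (q_fact (k + 2)) *
       to_fract (q_fact l) * to_fract (q_fact (l + 1)) * to_fract (q_fact (l + 2)))"
    using q_bracket_of_nat[of 2]
    unfolding generic.closed_form_def generic.ifact_def qfact_generic
    by (simp add: generic.br_1 nat divide_simps)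
  finally have "to_fract (theta_poly k l * (q_fact k * q_fact (k + 1) * q_fact (k + 2) *
     q_fact l * q_fact (l + 1) * q_fact (l + 2))) =
     to_fract (q_int 2 * q_fact (k + l) * q_fact (k + l + 1) * q_fact (k + l + 2))"
    by (simp add: q_fact_nonzero)
  then show ?thesis unfolding to_fract_eq_iff .
qed

text \<open>With \<open>N = k + l + 2\<close>, the denominator of \<open>\<Theta>\<close> is \<open>[N]\<^sup>2 [N-1] / [2]\<close>. Dividing \<open>[N]!\<^sup>3\<close> by it leaves
\<open>[2] [N]! [N-1]! [N-2]!\<close>, the numerator of the product formula.\<close>

lemma to_fract_theta_poly: "to_fract (theta_poly k l) = baxter_Theta k l"
proof -
  let ?f = "\<lambda>n. to_fract (q_fact n)"
  have nz: "?f n \<noteq> 0" for n by (simp add: q_fact_nonzero)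
  have "to_fract (theta_poly k l) * (?f k * ?f (k + 1) * ?f (k + 2) *
     ?f l * ?f (l + 1) * ?f (l + 2)) = ?f 2 * ?f (k + l) * ?f (k + l + 1) * ?f (k + l + 2)"
    using arg_cong[OF theta_poly_mult[of k l], of to_fract] by (simp add: q_fact_simps)
  then have theta: "to_fract (theta_poly k l) = ?f 2 * ?f (k + l) * ?f (k + l + 1) * ?f (k + l + 2) /
      (?f k * ?f (k + 1) * ?f (k + 2) * ?f l * ?f (l + 1) * ?f (l + 2))"
    using nz by (simp add: divide_simps)
  have b: "q_binomial (k + l + 1 + 1) k = ?f (k + l + 2) / (?f k * ?f (l + 2))"
    "q_binomial (k + l + 1 + 1) (k + 1) = ?f (k + l + 2) / (?f (k + 1) * ?f (l + 1))"
    "q_binomial (k + l + 1 + 1) (k + 2) = ?f (k + l + 2) / (?f (k + 2) * ?f l)"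
    "q_binomial (k + l + 1 + 1) 1 = ?f (k + l + 2) / ?f (k + l + 1)"
    "q_binomial (k + l + 1 + 1) 2 = ?f (k + l + 2) / (?f 2 * ?f (k + l))"
    by (simp_all add: q_binomial_def q_fact_simps eval_nat_numeral)
  show ?thesis
    unfolding theta baxter_Theta_def Let_def b using nz by (simp add: divide_simps mult_ac)
qed

lemma reflect_q_int: "reflect_poly (q_int j) = q_int j"
proof (cases "j = 0")
  case False
  have c: "coeff (q_int j) i = (if i < j then 1 else 0)" for i
    by (simp add: q_int_def coeff_sum)
  then have "degree (q_int j) = j - 1"
    using False by (intro antisym degree_le le_degree) auto
  then show ?thesis
    using False by (intro poly_eqI) (auto simp: coeff_reflect_poly c)
qed (simp add: q_int_def)

lemma reflect_q_fact: "reflect_poly (q_fact n) = q_fact n"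
  unfolding q_fact_def by (simp add: reflect_poly_prod reflect_q_int)

text \<open>Reflection of polynomials is multiplicative and fixes every \<open>q\<close>-factorial, so the quotient is
fixed as well.\<close>

lemma theta_poly_symmetric: "symmetric_coeffs (theta_poly k l)"
proof -
  let ?D = "q_fact k * q_fact (k + 1) * q_fact (k + 2) * q_fact l * q_fact (l + 1) * q_fact (l + 2)"
  have "reflect_poly (theta_poly k l) * ?D = reflect_poly (theta_poly k l * ?D)"
    by (simp only: reflect_poly_mult reflect_q_fact)
  also have "\<dots> = theta_poly k l * ?D"
    by (simp only: theta_poly_mult reflect_poly_mult reflect_q_fact reflect_q_int)
  finally have "reflect_poly (theta_poly k l) = theta_poly k l"
    by (simp add: q_fact_nonzero)
  then have "coeff (theta_poly k l) j = coeff (reflect_poly (theta_poly k l)) j" for j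
    by simp
  then show ?thesis
    unfolding symmetric_coeffs_def by (simp add: coeff_reflect_poly)
qed

section \<open>The value at -1\<close>

lemma q_int_even: "q_int (2 * r) = (X + 1) * (\<Sum>i<r. monom 1 (2 * i))"
proof (induction r)
  case (Suc r)
  then show ?case
    by (simp add: q_int_def algebra_simps mult_monom)
qed (simp add: q_int_def)

lemma poly_q_int_odd: "poly (q_int (2 * r + 1)) (-1) = 1"
  by (induction r) (auto simp: q_int_def poly_monom)

lemma q_fact_factor:
  "\<exists>g. q_fact m = (X + 1) ^ (m div 2) * g \<and> poly g (-1) = fact (m div 2)"
proof (induction m)
  case (Suc m)
  then obtain g where g: "q_fact m = (X + 1) ^ (m div 2) * g" "poly g (-1) = fact (m div 2)"
    by auto
  have fact_Suc: "q_fact (Suc m) = q_int (Suc m) * q_fact m"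
    by (simp add: q_fact_def)
  show ?case
  proof (cases "even m")
    case True
    then have "poly (q_int (Suc m)) (-1) = 1"
      using poly_q_int_odd[of "m div 2"] by simp
    then show ?thesis
      using True g by (intro exI[of _ "q_int (Suc m) * g"]) (simp add: fact_Suc mult_ac)
  next
    case False
    define r where "r = Suc (m div 2)"
    have r: "Suc m = 2 * r" "m div 2 = r - 1" "r > 0" using False by (auto simp: r_def)
    have "poly (\<Sum>i<r. monom 1 (2 * i)) (-1 :: int) = int r"
      by (simp add: poly_sum poly_monom)
    then show ?thesis
      using g unfolding fact_Suc unfolding r(1) q_int_even r(2)
      using r(3)
      by (intro exI[of _ "(\<Sum>i<r. monom 1 (2 * i)) * g"])
        (cases r, simp_all add: mult_ac)
  qed
qed (auto simp: q_fact_def)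

text \<open>The number \<open>d\<close> is the exponent of \<open>1 + q\<close> that survives the cancellation: it is 1 if \<open>k\<close> and \<open>l\<close>
are both odd, and 0 otherwise.\<close>

lemma theta_poly_at_minus_1_general:
  defines "e \<equiv> \<lambda>n. n div 2"
  assumes "e k + e (k + 1) + e (k + 2) + e l + e (l + 1) + e (l + 2) + d =
    1 + e (k + l) + e (k + l + 1) + e (k + l + 2)"
  shows "poly (theta_poly k l) (-1) * (fact (e k) * fact (e (k + 1)) * fact (e (k + 2)) *
     fact (e l) * fact (e (l + 1)) * fact (e (l + 2))) =
     0 ^ d * (fact (e (k + l)) * fact (e (k + l + 1)) * fact (e (k + l + 2)))"
proof -
  obtain g where g: "\<And>m. q_fact m = (X + 1) ^ e m * g m" "\<And>m. poly (g m) (-1) = fact (e m)"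
    using q_fact_factor unfolding e_def by metis
  have two: "q_int 2 = X + 1"
    using q_int_even[of 1] by simp
  have "theta_poly k l * (g k * g (k + 1) * g (k + 2) * g l * g (l + 1) * g (l + 2)) *
      (X + 1) ^ (e k + e (k + 1) + e (k + 2) + e l + e (l + 1) + e (l + 2)) =
    (X + 1) ^ (1 + e (k + l) + e (k + l + 1) + e (k + l + 2)) *
      (g (k + l) * g (k + l + 1) * g (k + l + 2))"
    using theta_poly_mult[of k l] unfolding g(1) two by (simp add: power_add mult_ac)
  also have "\<dots> = (X + 1) ^ d * (g (k + l) * g (k + l + 1) * g (k + l + 2)) *
     (X + 1) ^ (e k + e (k + 1) + e (k + 2) + e l + e (l + 1) + e (l + 2))"
    unfolding assms(2)[symmetric] by (simp add: power_add mult_ac)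
  finally have "theta_poly k l * (g k * g (k + 1) * g (k + 2) * g l * g (l + 1) * g (l + 2)) =
    (X + 1) ^ d * (g (k + l) * g (k + l + 1) * g (k + l + 2))"
    using q_int_nonzero[of 2] unfolding two by simp
  from arg_cong[OF this, of "\<lambda>p. poly p (-1)"] show ?thesis
    by (simp add: g(2) poly_monom)
qed

lemma theta_poly_at_minus_1:
  shows "poly (theta_poly (2 * a) (2 * b)) (-1) * (fact a ^ 2 * fact (a + 1) * (fact b ^ 2 * fact (b + 1))) =
      fact (a + b) ^ 2 * fact (a + b + 1)" (is ?even)
    and "poly (theta_poly (2 * a) (2 * b + 1)) (-1) * (fact a ^ 2 * fact (a + 1) * (fact b * fact (b + 1) ^ 2)) =
      fact (a + b) * fact (a + b + 1) ^ 2" (is ?even_odd)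
    and "poly (theta_poly (2 * a + 1) (2 * b)) (-1) * (fact a * fact (a + 1) ^ 2 * (fact b ^ 2 * fact (b + 1))) =
      fact (a + b) * fact (a + b + 1) ^ 2" (is ?odd_even)
    and "poly (theta_poly (2 * a + 1) (2 * b + 1)) (-1) = 0" (is ?odd)
proof -
  have div: "(2 * a + 2 * b + 1) div 2 = a + b" "(2 * a + 2 * b + 2) div 2 = a + b + 1"
    "(2 * a + 2 * b + 3) div 2 = a + b + 1" "(2 * a + 2 * b) div 2 = a + b"
    "(2 * a + 2 * b + 4) div 2 = a + b + 2" by presburger+
  show ?even
    using theta_poly_at_minus_1_general[of "2 * a" "2 * b" 0]
    by (simp add: div power2_eq_square mult_ac)
  show ?even_odd
    using theta_poly_at_minus_1_general[of "2 * a" "2 * b + 1" 0]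
    by (simp add: div power2_eq_square mult_ac)
  show ?odd_even
    using theta_poly_at_minus_1_general[of "2 * a + 1" "2 * b" 0]
    by (simp add: div power2_eq_square mult_ac)
  show ?odd
    using theta_poly_at_minus_1_general[of "2 * a + 1" "2 * b + 1" 1]
    by (simp add: div)
qed

section \<open>Summing path counts over symmetric end points\<close>

lemma ifact_of_nat: "at_one.ifact (int n) = 1 / fact n"
  by (simp add: at_one.ifact_def qfact_at_one divide_inverse)

lemma rising_nonzero: "(of_nat m + 1) * (of_nat m + 2) \<noteq> (0 :: rat)"
  using of_nat_0_le_iff[of m, where 'a = rat] by (simp del: of_nat_0_le_iff)

lemma eq_divide_mult:
  fixes c :: "'a::field"
  shows "c \<noteq> 0 \<Longrightarrow> x * c = p / d \<Longrightarrow> x = p / (d * c)"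
  by (metis divide_divide_eq_left nonzero_mult_div_cancel_right)

text \<open>Put \<open>A = a + 1\<close>, \<open>B = b + 1\<close> and \<open>t = s + 1\<close>. For
\<open>T(t) = 1 / ((A+t-1)! (A-t)! (B-t)! (B+t-1)!)\<close> the difference \<open>T(t) - T(t+1)\<close> has numerator
\<open>2 t (A + B)\<close> over the denominator of the summand. To get the numerator \<open>2 t\<^sup>3\<close>, multiply \<open>T(t)\<close>
by a quadratic \<open>t (t - 1) + \<kappa>\<close> and choose \<open>\<kappa>\<close> such that the linear term cancels. The function \<open>H\<close>
is \<open>A + B\<close> times this product, and its differences are \<open>(A + B) (A + B - 1)\<close> times the summands.\<close>

lemma sum_ifact_cubes:
  assumes "a \<le> n"
  shows "(\<Sum>s\<le>n. 2 * (of_nat s + 1) ^ 3 *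
      (at_one.ifact (int a + int s + 2) * at_one.ifact (int a - int s) *
       at_one.ifact (int b - int s) * at_one.ifact (int b + int s + 2))) =
    1 / (fact a ^ 2 * fact b ^ 2 * ((of_nat (a + b) + 1) * (of_nat (a + b) + 2)))"
    (is "sum ?t _ = _")
proof -
  define H where "H s = ((of_nat s + 1) * of_nat s * (of_nat (a + b) + 2) + (of_nat a + 1) * (of_nat b + 1)) *
    (at_one.ifact (int a + int s + 1) * at_one.ifact (int a - int s) *
     at_one.ifact (int b - int s) * at_one.ifact (int b + int s + 1))" for s :: nat
  have step: "((of_nat (a + b) + 1) * (of_nat (a + b) + 2)) * ?t s = H s - H (Suc s)" for s
  proof -
    note r = at_one.ifact_minus_1[of "int a + int s + 2"] at_one.ifact_minus_1[of "int b + int s + 2"]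
      at_one.ifact_minus_1[of "int a - int s"] at_one.ifact_minus_1[of "int b - int s"]
    have e: "at_one.ifact (int a + int s + 1) = (of_nat a + of_nat s + 2) * at_one.ifact (int a + int s + 2)"
      "at_one.ifact (int b + int s + 1) = (of_nat b + of_nat s + 2) * at_one.ifact (int b + int s + 2)"
      "at_one.ifact (int a - int (Suc s)) = (of_nat a - of_nat s) * at_one.ifact (int a - int s)"
      "at_one.ifact (int b - int (Suc s)) = (of_nat b - of_nat s) * at_one.ifact (int b - int s)"
      "at_one.ifact (int a + int (Suc s) + 1) = at_one.ifact (int a + int s + 2)"
      "at_one.ifact (int b + int (Suc s) + 1) = at_one.ifact (int b + int s + 2)"
      using r by (simp_all add: algebra_simps)
    show ?thesis
      unfolding H_def e by (simp add: algebra_simps power3_eq_cube)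
  qed
  have "((of_nat (a + b) + 1) * (of_nat (a + b) + 2)) * sum ?t {..n} = (\<Sum>s\<le>n. H s - H (Suc s))"
    by (simp only: sum_distrib_left step)
  also have "\<dots> = H 0 - H (Suc n)"
    by (rule sum_telescope)
  also have "H (Suc n) = 0"
    using assms by (simp add: H_def at_one.ifact_def)
  also have "H 0 = 1 / (fact a ^ 2 * fact b ^ 2)"
  proof -
    have "H 0 = ((of_nat a + 1) * at_one.ifact (int a + 1)) * at_one.ifact (int a) *
        (at_one.ifact (int b) * ((of_nat b + 1) * at_one.ifact (int b + 1)))"
      by (simp add: H_def)
    also have "\<dots> = at_one.ifact (int a) * at_one.ifact (int a) * (at_one.ifact (int b) * at_one.ifact (int b))"
      using at_one.ifact_minus_1[of "int a + 1"] at_one.ifact_minus_1[of "int b + 1"] by simp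
    finally show ?thesis by (simp add: ifact_of_nat power2_eq_square)
  qed
  finally have "sum ?t {..n} * ((of_nat (a + b) + 1) * (of_nat (a + b) + 2)) =
      1 / (fact a ^ 2 * fact b ^ 2)"
    by (simp only: diff_0_right mult.commute)
  then show ?thesis
    by (rule eq_divide_mult[OF rising_nonzero])
qed

text \<open>The same telescoping as in \<open>sum_ifact_cubes\<close>, now with \<open>A = a + 1/2\<close>, \<open>B = b + 3/2\<close> and
\<open>t = s + 3/2\<close>: the numerator \<open>(s + 1) (s + 2) (2 s + 3)\<close> is \<open>2 (t\<^sup>3 - t / 4)\<close>.\<close>

lemma sum_ifact_half_cubes:
  assumes "a \<le> n"
  shows "(\<Sum>s\<le>n. (of_nat s + 1) * (of_nat s + 2) * (2 * of_nat s + 3) *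
      (at_one.ifact (int a + int s + 2) * at_one.ifact (int a - int s - 1) *
       at_one.ifact (int b - int s) * at_one.ifact (int b + int s + 3))) =
    of_nat a / (fact a ^ 2 * fact b * fact (b + 1) * ((of_nat (a + b) + 1) * (of_nat (a + b) + 2)))"
    (is "sum ?t _ = _")
proof -
  define H where "H s = (of_nat s * (of_nat s + 2) * (of_nat (a + b) + 2) + (of_nat a + 1) * (of_nat b + 2)) *
    (at_one.ifact (int a + int s + 1) * at_one.ifact (int a - int s - 1) *
     at_one.ifact (int b - int s) * at_one.ifact (int b + int s + 2))" for s :: nat
  have step: "((of_nat (a + b) + 1) * (of_nat (a + b) + 2)) * ?t s = H s - H (Suc s)" for s
  proof -
    note r = at_one.ifact_minus_1[of "int a + int s + 2"] at_one.ifact_minus_1[of "int b + int s + 3"]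
      at_one.ifact_minus_1[of "int a - int s - 1"] at_one.ifact_minus_1[of "int b - int s"]
    have e: "at_one.ifact (int a + int s + 1) = (of_nat a + of_nat s + 2) * at_one.ifact (int a + int s + 2)"
      "at_one.ifact (int b + int s + 2) = (of_nat b + of_nat s + 3) * at_one.ifact (int b + int s + 3)"
      "at_one.ifact (int a - int (Suc s) - 1) = (of_nat a - of_nat s - 1) * at_one.ifact (int a - int s - 1)"
      "at_one.ifact (int b - int (Suc s)) = (of_nat b - of_nat s) * at_one.ifact (int b - int s)"
      "at_one.ifact (int a + int (Suc s) + 1) = at_one.ifact (int a + int s + 2)"
      "at_one.ifact (int b + int (Suc s) + 2) = at_one.ifact (int b + int s + 3)"
      using r by (simp_all add: algebra_simps)
    show ?thesis
      unfolding H_def e by (simp add: algebra_simps)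
  qed
  have "((of_nat (a + b) + 1) * (of_nat (a + b) + 2)) * sum ?t {..n} = (\<Sum>s\<le>n. H s - H (Suc s))"
    by (simp only: sum_distrib_left step)
  also have "\<dots> = H 0 - H (Suc n)"
    by (rule sum_telescope)
  also have "H (Suc n) = 0"
    using assms by (simp add: H_def at_one.ifact_def)
  also have "H 0 = of_nat a / (fact a ^ 2 * fact b * fact (b + 1))"
  proof -
    have "H 0 = ((of_nat a + 1) * at_one.ifact (int a + 1)) * at_one.ifact (int a - 1) *
        (at_one.ifact (int b) * ((of_nat b + 2) * at_one.ifact (int b + 2)))"
      by (simp add: H_def)
    also have "\<dots> = at_one.ifact (int a) * (of_nat a * at_one.ifact (int a)) *
        (at_one.ifact (int b) * at_one.ifact (int (b + 1)))"
      using at_one.ifact_minus_1[of "int a + 1"] at_one.ifact_minus_1[of "int b + 2"]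
        at_one.ifact_minus_1[of "int a"] by (simp add: add.commute)
    finally show ?thesis unfolding ifact_of_nat by (simp add: power2_eq_square)
  qed
  finally have "sum ?t {..n} * ((of_nat (a + b) + 1) * (of_nat (a + b) + 2)) =
      of_nat a / (fact a ^ 2 * fact b * fact (b + 1))"
    by (simp only: diff_0_right mult.commute)
  then show ?thesis
    by (rule eq_divide_mult[OF rising_nonzero])
qed

definition path_count :: "nat \<Rightarrow> int \<Rightarrow> int \<Rightarrow> int \<Rightarrow> int" where
  "path_count = path_sum 1"

lemma path_count_closed_form:
  assumes "c \<le> b" "b \<le> a"
  shows "of_int (path_count n a b c) =
     of_int (a - b + 1) * of_int (a - c + 2) * of_int (b - c + 1) *
     (fact n * fact (n + 1) * fact (n + 2)) *
     (at_one.ifact (a + 2) * at_one.ifact (int n - a)) *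
     (at_one.ifact (b + 1) * at_one.ifact (int n + 1 - b)) *
     (at_one.ifact c * at_one.ifact (int n + 2 - c))"
  unfolding path_count_def of_int_path_sum at_one.path_sum_eq_closed_form[OF assms]
    at_one.closed_form_def qfact_at_one ..

text \<open>All families of end points in question share the factors that depend only on \<open>n = a + b\<close> and on
the middle height \<open>a\<close>; this pulls them out of the sum.\<close>

lemma sum_path_count:
  fixes f :: "nat \<Rightarrow> rat"
  assumes "\<And>s. of_int (path_count (a + b) (x s) (int a) (z s)) =
      (fact (a + b) * fact (a + b + 1) * fact (a + b + 2) *
        (at_one.ifact (int a + 1) * at_one.ifact (int b + 1))) * f s"
    and "sum f {..a + b} = S / ((of_nat (a + b) + 1) * (of_nat (a + b) + 2))"
  shows "(\<Sum>s\<le>a + b. of_int (path_count (a + b) (x s) (int a) (z s))) =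
     fact (a + b) ^ 2 * fact (a + b + 1) / (fact (a + 1) * fact (b + 1)) * S"
proof -
  let ?n = "of_nat (a + b) :: rat"
  have i: "at_one.ifact (int a + 1) = 1 / fact (a + 1)" "at_one.ifact (int b + 1) = 1 / fact (b + 1)"
    using ifact_of_nat[of "a + 1"] ifact_of_nat[of "b + 1"] by (simp_all add: add.commute)
  have f: "fact (a + b + 2) = ((?n + 1) * (?n + 2)) * fact (a + b)"
    by (simp add: algebra_simps)
  note nz = rising_nonzero[of "a + b"]
  have "(\<Sum>s\<le>a + b. of_int (path_count (a + b) (x s) (int a) (z s))) =
     fact (a + b) * fact (a + b + 1) * (((?n + 1) * (?n + 2)) * fact (a + b)) *
        (1 / fact (a + 1) * (1 / fact (b + 1))) * (S / ((?n + 1) * (?n + 2)))"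
    unfolding assms(1) sum_distrib_left[symmetric] assms(2) i f ..
  also have "\<dots> = fact (a + b) ^ 2 * fact (a + b + 1) / (fact (a + 1) * fact (b + 1)) * S"
  proof -
    have "F * G * (c * F) * (1 / U * (1 / V)) * (S / c) = F ^ 2 * G / (U * V) * S"
      if "c \<noteq> 0" for F G U V c :: rat
      using that by (simp add: power2_eq_square)
    from this[OF nz] show ?thesis .
  qed
  finally show ?thesis .
qed

lemma sum_path_count_centred:
  "(\<Sum>s\<le>a + b. of_int (path_count (a + b) (int a + int s) (int a) (int a - int s))) =
     (fact (a + b) ^ 2 * fact (a + b + 1) / (fact (a + 1) * fact (b + 1)) *
       (1 / (fact a ^ 2 * fact b ^ 2)) :: rat)"
proof (rule sum_path_count)
  fix s
  have e: "int (a + b) - (int a + int s) = int b - int s"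
    "int (a + b) + 2 - (int a - int s) = int b + int s + 2"
    "int (a + b) + 1 - int a = int b + 1" "int a + int s - int a + 1 = int s + 1"
    "int a + int s - (int a - int s) + 2 = 2 * (int s + 1)" "int a - (int a - int s) + 1 = int s + 1"
    by simp_all
  show "of_int (path_count (a + b) (int a + int s) (int a) (int a - int s)) =
      (fact (a + b) * fact (a + b + 1) * fact (a + b + 2) *
        (at_one.ifact (int a + 1) * at_one.ifact (int b + 1))) *
      (2 * (of_nat s + 1) ^ 3 *
      (at_one.ifact (int a + int s + 2) * at_one.ifact (int a - int s) *
       at_one.ifact (int b - int s) * at_one.ifact (int b + int s + 2)))"
    by (subst path_count_closed_form; (simp only: e)?)
      (simp_all add: power3_eq_cube mult_ac del: fact_Suc add_2_eq_Suc')
qed (subst sum_ifact_cubes, simp_all add: mult_ac)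

lemma sum_path_count_low:
  "(\<Sum>s\<le>a + b. of_int (path_count (a + b) (int a + int s) (int a) (int a - int s - 1))) =
     (fact (a + b) ^ 2 * fact (a + b + 1) / (fact (a + 1) * fact (b + 1)) *
       (of_nat a / (fact a ^ 2 * fact b * fact (b + 1))) :: rat)"
proof (rule sum_path_count)
  fix s
  have e: "int (a + b) - (int a + int s) = int b - int s"
    "int (a + b) + 2 - (int a - int s - 1) = int b + int s + 3"
    "int (a + b) + 1 - int a = int b + 1" "int a + int s - int a + 1 = int s + 1"
    "int a + int s - (int a - int s - 1) + 2 = 2 * int s + 3"
    "int a - (int a - int s - 1) + 1 = int s + 2"
    by simp_all
  show "of_int (path_count (a + b) (int a + int s) (int a) (int a - int s - 1)) =
      (fact (a + b) * fact (a + b + 1) * fact (a + b + 2) *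
        (at_one.ifact (int a + 1) * at_one.ifact (int b + 1))) *
      ((of_nat s + 1) * (of_nat s + 2) * (2 * of_nat s + 3) *
      (at_one.ifact (int a + int s + 2) * at_one.ifact (int a - int s - 1) *
       at_one.ifact (int b - int s) * at_one.ifact (int b + int s + 3)))"
    by (subst path_count_closed_form; (simp only: e)?)
      (simp_all add: mult_ac del: fact_Suc add_2_eq_Suc')
qed (subst sum_ifact_half_cubes, simp_all add: mult_ac)

lemma sum_path_count_high:
  "(\<Sum>s\<le>a + b. of_int (path_count (a + b) (int a + int s + 1) (int a) (int a - int s))) =
     (fact (a + b) ^ 2 * fact (a + b + 1) / (fact (a + 1) * fact (b + 1)) *
       (of_nat b / (fact b ^ 2 * fact a * fact (a + 1))) :: rat)"
proof (rule sum_path_count)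
  fix s
  have e: "int (a + b) - (int a + int s + 1) = int b - int s - 1"
    "int (a + b) + 2 - (int a - int s) = int b + int s + 2"
    "int (a + b) + 1 - int a = int b + 1" "int a + int s + 1 - int a + 1 = int s + 2"
    "int a + int s + 1 - (int a - int s) + 2 = 2 * int s + 3"
    "int a - (int a - int s) + 1 = int s + 1" "int a + int s + 1 + 2 = int a + int s + 3"
    by simp_all
  show "of_int (path_count (a + b) (int a + int s + 1) (int a) (int a - int s)) =
      (fact (a + b) * fact (a + b + 1) * fact (a + b + 2) *
        (at_one.ifact (int a + 1) * at_one.ifact (int b + 1))) *
      ((of_nat s + 1) * (of_nat s + 2) * (2 * of_nat s + 3) *
      (at_one.ifact (int b + int s + 2) * at_one.ifact (int b - int s - 1) *
       at_one.ifact (int a - int s) * at_one.ifact (int a + int s + 3)))"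
    by (subst path_count_closed_form; (simp only: e)?)
      (simp_all add: mult_ac del: fact_Suc add_2_eq_Suc')
qed (subst sum_ifact_half_cubes, simp_all add: mult_ac add.commute)

section \<open>Young diagrams and their boundary paths\<close>

text \<open>The height of a path after \<open>t\<close> steps, for a path from the lower left to the upper right corner of
a rectangle with \<open>k\<close> rows and \<open>l\<close> columns.\<close>

definition lattice_path :: "nat \<Rightarrow> nat \<Rightarrow> (nat \<Rightarrow> int) \<Rightarrow> bool" where
  "lattice_path k l h \<longleftrightarrow> h 0 = 0 \<and> h (k + l) = int k \<and>
     (\<forall>t<k + l. h t \<le> h (Suc t) \<and> h (Suc t) \<le> h t + 1)"

text \<open>Rows are numbered from the top. The lower right corner of the cell \<open>(i, j)\<close> is passed, on its
diagonal, at time \<open>k + j - i\<close>, and lies \<open>k - i\<close> above the bottom; the cell is on the upper left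
side if the path is at most that high then.\<close>

definition cells_above :: "nat \<Rightarrow> nat \<Rightarrow> (nat \<Rightarrow> int) \<Rightarrow> (nat \<times> nat) set" where
  "cells_above k l h = {(i, j) \<in> {1..k} \<times> {1..l}. h (k + j - i) + int i \<le> int k}"

definition diagram :: "nat \<Rightarrow> nat \<Rightarrow> (nat \<times> nat) set \<Rightarrow> bool" where
  "diagram k l A \<longleftrightarrow> A \<subseteq> {1..k} \<times> {1..l} \<and>
     (\<forall>i j i' j'. (i, j) \<in> A \<longrightarrow> 1 \<le> i' \<longrightarrow> i' \<le> i \<longrightarrow> 1 \<le> j' \<longrightarrow> j' \<le> j \<longrightarrow> (i', j') \<in> A)"

text \<open>The rows whose cell on the diagonal of time \<open>t\<close> is outside \<open>A\<close>. Positions to the left of the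
rectangle count as inside, those to its right as outside. If \<open>A\<close> is a diagram, these are the
lowest rows, and their number is the height of the boundary path at time \<open>t\<close>.\<close>

definition rows_below :: "nat \<Rightarrow> nat \<Rightarrow> (nat \<times> nat) set \<Rightarrow> nat \<Rightarrow> nat set" where
  "rows_below k l A t =
     {i \<in> {1..k}. k < i + t \<and> (i + t \<le> k + l \<longrightarrow> (i, i + t - k) \<notin> A)}"

definition boundary :: "nat \<Rightarrow> nat \<Rightarrow> (nat \<times> nat) set \<Rightarrow> nat \<Rightarrow> int" where
  "boundary k l A t = int (card (rows_below k l A t))"

lemma lattice_path_increment:
  assumes "lattice_path k l h" "s + d \<le> k + l"
  shows "h s \<le> h (s + d) \<and> h (s + d) \<le> h s + int d"
  using assms(2)
proof (induction d)
  case (Suc d)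
  have "h (s + d) \<le> h (Suc (s + d)) \<and> h (Suc (s + d)) \<le> h (s + d) + 1"
    using assms(1) Suc.prems unfolding lattice_path_def by simp
  with Suc show ?case by auto
qed auto

lemma lattice_path_bounds:
  assumes "lattice_path k l h" "t \<le> k + l"
  shows "0 \<le> h t" "h t \<le> int t" "h t \<le> int k" "int t \<le> h t + int l"
  using lattice_path_increment[OF assms(1), of 0 t] lattice_path_increment[OF assms(1), of t "k + l - t"]
    assms unfolding lattice_path_def by auto

lemma diagram_cells_above:
  assumes h: "lattice_path k l h"
  shows "diagram k l (cells_above k l h)"
  unfolding diagram_def
proof (intro conjI allI impI)
  fix i j i' j'
  assume A: "(i, j) \<in> cells_above k l h" "1 \<le> i'" "i' \<le> i" "1 \<le> j'" "j' \<le> j"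
  then have "h (k + j' - i') \<le> h (k + j - i')" "h (k + j - i') \<le> h (k + j - i) + int (i - i')"
    using lattice_path_increment[OF h, of "k + j' - i'" "j - j'"]
      lattice_path_increment[OF h, of "k + j - i" "i - i'"]
    by (auto simp: cells_above_def)
  then show "(i', j') \<in> cells_above k l h"
    using A by (auto simp: cells_above_def)
qed (auto simp: cells_above_def)

lemma card_upper_segment:
  assumes "m \<le> k"
  shows "card {i \<in> {1..k}. k < m + i} = m"
proof -
  have "{i \<in> {1..k}. k < m + i} = {k - m<..k}" by auto
  then show ?thesis using assms by simp
qed

text \<open>Together with \<open>cells_above_boundary\<close> and \<open>lattice_path_boundary\<close> this makes diagrams and lattice
paths correspond bijectively.\<close>

lemma boundary_cells_above:
  assumes h: "lattice_path k l h" and t: "t \<le> k + l"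
  shows "boundary k l (cells_above k l h) t = h t"
proof -
  note b = lattice_path_bounds[OF h t]
  have "rows_below k l (cells_above k l h) t = {i \<in> {1..k}. k < nat (h t) + i}"
    using b by (auto simp: rows_below_def cells_above_def)
  then show ?thesis
    using b card_upper_segment[of "nat (h t)" k] by (simp add: boundary_def)
qed

text \<open>Moving down and to the right along a diagonal, one never re-enters a diagram.\<close>

lemma rows_below_eq:
  assumes A: "diagram k l A"
  shows "rows_below k l A t = {i \<in> {1..k}. k < card (rows_below k l A t) + i}"
proof -
  let ?S = "rows_below k l A t"
  have S: "?S \<subseteq> {1..k}" by (auto simp: rows_below_def)
  have up: "i' \<in> ?S" if "i \<in> ?S" "i \<le> i'" "i' \<le> k" for i i'
    using that A unfolding rows_below_def diagram_def by fastforce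
  have "{k - card ?S<..k} = ?S"
  proof (cases "?S = {}")
    case False
    define m where "m = Min ?S"
    have fin: "finite ?S" using S finite_subset by blast
    have m: "m \<in> ?S" using False fin by (simp add: m_def)
    have "rows_below k l A t = {m..k}"
      using S up[OF m] Min_le[OF fin] by (auto simp: m_def)
    moreover have "1 \<le> m" "m \<le> k" using m S by auto
    then have "{k - card {m..k}<..k} = {m..k}" by auto
    ultimately show ?thesis by metis
  qed auto
  moreover have "{i \<in> {1..k}. k < n + i} = {k - n<..k}" for n
    by auto
  ultimately show ?thesis by metis
qed

lemma cells_above_boundary:
  assumes A: "diagram k l A"
  shows "cells_above k l (boundary k l A) = A"
proof -
  have "(i, j) \<in> A \<longleftrightarrow> boundary k l A (k + j - i) + int i \<le> int k"
    if ij: "i \<in> {1..k}" "j \<in> {1..l}" for i j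
  proof -
    have "i \<in> rows_below k l A (k + j - i) \<longleftrightarrow> (i, j) \<notin> A"
      using ij by (auto simp: rows_below_def)
    moreover have "i \<in> rows_below k l A (k + j - i) \<longleftrightarrow>
        k < card (rows_below k l A (k + j - i)) + i"
      using ij rows_below_eq[OF A, of "k + j - i"] by blast
    ultimately show ?thesis by (auto simp: boundary_def)
  qed
  moreover have "A \<subseteq> {1..k} \<times> {1..l}" using A by (simp add: diagram_def)
  ultimately show ?thesis unfolding cells_above_def by auto
qed

lemma lattice_path_boundary:
  assumes A: "diagram k l A"
  shows "lattice_path k l (boundary k l A)"
  unfolding lattice_path_def
proof (intro conjI allI impI)
  have "rows_below k l A 0 = {}" by (auto simp: rows_below_def)
  then show "boundary k l A 0 = 0" by (simp add: boundary_def)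
  have "rows_below k l A (k + l) = {1..k}"
    using A by (auto simp: rows_below_def diagram_def)
  then show "boundary k l A (k + l) = int k" by (simp add: boundary_def)
  fix t
  let ?S = "rows_below k l A t" and ?S' = "rows_below k l A (Suc t)"
  have fin: "finite (rows_below k l A s)" for s by (simp add: rows_below_def)
  have "?S \<subseteq> ?S'"
  proof
    fix i assume i: "i \<in> ?S"
    have "(i, i + t - k) \<in> A" if "(i, i + Suc t - k) \<in> A"
      using A that i unfolding diagram_def rows_below_def by fastforce
    then show "i \<in> ?S'" using i by (auto simp: rows_below_def)
  qed
  then show "boundary k l A t \<le> boundary k l A (Suc t)"
    by (simp add: boundary_def card_mono fin)
  \<comment> \<open>The cell below a cell on the diagonal of time \<open>t + 1\<close> is on the diagonal of time \<open>t\<close>.\<close>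
  have "Suc ` (?S' - {k}) \<subseteq> ?S"
  proof
    fix i' assume "i' \<in> Suc ` (?S' - {k})"
    then obtain i where i: "i' = Suc i" "i \<in> ?S'" "i \<noteq> k" by auto
    have "(i, i + Suc t - k) \<in> A" if "(Suc i, Suc i + t - k) \<in> A"
      using A that i unfolding diagram_def rows_below_def by fastforce
    then show "i' \<in> ?S" using i by (auto simp: rows_below_def)
  qed
  then have "card (?S' - {k}) \<le> card ?S"
    using card_mono[OF fin] by (metis card_image inj_Suc inj_on_subset top_greatest)
  then show "boundary k l A (Suc t) \<le> boundary k l A t + 1"
    using card_Suc_Diff1[OF fin, of k "Suc t"] by (cases "k \<in> ?S'") (auto simp: boundary_def)
qed

definition complementary_cells :: "nat \<Rightarrow> nat \<Rightarrow> (nat \<times> nat) set \<Rightarrow> (nat \<times> nat) set" where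
  "complementary_cells k l A = {(i, j) \<in> {1..k} \<times> {1..l}. (k + 1 - i, l + 1 - j) \<notin> A}"

lemma lattice_path_reverse:
  assumes "lattice_path k l h"
  shows "lattice_path k l (\<lambda>t. int k - h (k + l - t))"
  unfolding lattice_path_def
proof (intro conjI allI impI)
  fix t assume "t < k + l"
  then have "Suc (k + l - Suc t) = k + l - t" "k + l - Suc t < k + l" by auto
  then show "int k - h (k + l - t) \<le> int k - h (k + l - Suc t)"
    "int k - h (k + l - Suc t) \<le> int k - h (k + l - t) + 1"
    using assms unfolding lattice_path_def by (metis diff_left_mono, smt (verit))
qed (use assms in \<open>auto simp: lattice_path_def\<close>)

lemma cells_above_reverse:
  "cells_above k l (\<lambda>t. int k - h (k + l - t)) = complementary_cells k l (cells_above k l h)"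
proof -
  have "k + l - (k + j - i) = k + (l + 1 - j) - (k + 1 - i)" if "i \<in> {1..k}" "j \<in> {1..l}" for i j
    using that by auto
  then show ?thesis
    by (auto simp: cells_above_def complementary_cells_def)
qed

text \<open>Half a turn of the rectangle reverses the boundary path. The proof goes through the path: the
reversed path bounds the complementary cells, and a path is recovered from its cells.\<close>

lemma boundary_complementary_cells:
  assumes A: "diagram k l A" and t: "t \<le> k + l"
  shows "boundary k l (complementary_cells k l A) t = int k - boundary k l A (k + l - t)"
  using boundary_cells_above[OF lattice_path_reverse[OF lattice_path_boundary[OF A]] t]
  by (simp add: cells_above_reverse cells_above_boundary[OF A])

lemma boundary_antimono:
  assumes "A \<subseteq> B"
  shows "boundary k l B t \<le> boundary k l A t"
  unfolding boundary_def rows_below_def using assms by (auto intro!: card_mono)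

section \<open>Counting nested triples of paths\<close>

definition nested :: "int \<times> int \<times> int \<Rightarrow> bool" where
  "nested = (\<lambda>(x, y, z). z \<le> y \<and> y \<le> x)"

definition unit_step :: "int \<times> int \<times> int \<Rightarrow> int \<times> int \<times> int \<Rightarrow> bool" where
  "unit_step = (\<lambda>(x, y, z) (x', y', z'). x' - x \<in> {0, 1} \<and> y' - y \<in> {0, 1} \<and> z' - z \<in> {0, 1})"

text \<open>Paths as functions of time, undefined after time \<open>n\<close> so that each is counted once. The components
are ordered from the highest path to the lowest, that is, from the smallest diagram to the
largest.\<close>

definition triple_paths :: "nat \<Rightarrow> int \<times> int \<times> int \<Rightarrow> (nat \<Rightarrow> int \<times> int \<times> int) set" where
  "triple_paths n v = {f \<in> extensional {..n}. f 0 = (0, 0, 0) \<and> f n = v \<and>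
     (\<forall>t\<le>n. nested (f t)) \<and> (\<forall>t<n. unit_step (f t) (f (Suc t)))}"

lemma triple_paths_0: "triple_paths 0 v = (if v = (0, 0, 0) then {(\<lambda>t\<in>{..0}. v)} else {})"
  by (auto simp: triple_paths_def nested_def extensional_def fun_eq_iff)

text \<open>Removing the last point of a path shows that the sets obey the recurrence of \<open>path_sum\<close>.\<close>

lemma triple_paths_Suc:
  "triple_paths (Suc n) (a, b, c) = (if nested (a, b, c) then
     (\<Union>(e, f, g)\<in>{0, 1} \<times> {0, 1} \<times> {0, 1}.
        (\<lambda>p. p(Suc n := (a, b, c))) ` triple_paths n (a - e, b - f, c - g)) else {})"
  (is "_ = (if _ then ?U else {})")
proof -
  have sub: "p \<in> ?U" if p: "p \<in> triple_paths (Suc n) (a, b, c)" for p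
  proof -
    obtain x y z where v: "p n = (x, y, z)" by (cases "p n")
    have "unit_step (p n) (p (Suc n))" "p (Suc n) = (a, b, c)"
      using p by (auto simp: triple_paths_def)
    then have d: "a - x \<in> {0, 1}" "b - y \<in> {0, 1}" "c - z \<in> {0, 1}"
      by (auto simp: v unit_step_def)
    define p' where "p' = p(Suc n := undefined)"
    have "p' \<in> triple_paths n (a - (a - x), b - (b - y), c - (c - z))"
      using p v by (auto simp: triple_paths_def p'_def extensional_def)
    moreover have "p = p'(Suc n := (a, b, c))"
      using p by (auto simp: triple_paths_def p'_def)
    ultimately show ?thesis
      using d by (intro UN_I[of "(a - x, b - y, c - z)"]) auto
  qed
  have ext: "p(Suc n := (a, b, c)) \<in> triple_paths (Suc n) (a, b, c)"
    if "p \<in> triple_paths n (a - e, b - f, c - g)" "e \<in> {0, 1}" "f \<in> {0, 1}" "g \<in> {0, 1}"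
      "nested (a, b, c)" for p e f g
    using that
    by (auto simp: triple_paths_def extensional_def unit_step_def less_Suc_eq le_Suc_eq)
  have sup: "?U \<subseteq> triple_paths (Suc n) (a, b, c)" if "nested (a, b, c)"
  proof
    fix p assume "p \<in> ?U"
    then obtain i where i: "i \<in> {0, 1} \<times> {0, 1} \<times> {0, 1}"
      "p \<in> (case i of (e, f, g) \<Rightarrow> (\<lambda>p. p(Suc n := (a, b, c))) ` triple_paths n (a - e, b - f, c - g))"
      by (rule UN_E)
    obtain e f g where efg: "i = (e, f, g)" by (cases i)
    obtain p' where "p = p'(Suc n := (a, b, c))" "p' \<in> triple_paths n (a - e, b - f, c - g)"
      using i(2) unfolding efg by auto
    then show "p \<in> triple_paths (Suc n) (a, b, c)"
      using ext[of p' e f g] that i(1) unfolding efg by auto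
  qed
  have nested: "nested (a, b, c)" if "p \<in> triple_paths (Suc n) (a, b, c)" for p
    using that by (auto simp: triple_paths_def)
  show ?thesis
  proof (cases "nested (a, b, c)")
    case True
    have "triple_paths (Suc n) (a, b, c) = ?U"
    proof
      show "triple_paths (Suc n) (a, b, c) \<subseteq> ?U"
        by (rule subsetI) (rule sub)
    qed (rule sup[OF True])
    then show ?thesis by (simp only: True if_True)
  next
    case False
    then have "triple_paths (Suc n) (a, b, c) = {}" using nested by blast
    then show ?thesis by (simp only: False if_False)
  qed
qed

lemma card_triple_paths:
  "finite (triple_paths n (a, b, c)) \<and> int (card (triple_paths n (a, b, c))) = path_count n a b c"
proof (induction n arbitrary: a b c)
  case 0
  then show ?case by (auto simp: triple_paths_0 path_count_def)
next
  case (Suc n)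
  let ?I = "{0, 1::int} \<times> {0, 1::int} \<times> {0, 1::int}"
  let ?P = "\<lambda>(e, f, g). triple_paths n (a - e, b - f, c - g)"
  let ?ext = "\<lambda>p. p(Suc n := (a, b, c))"
  show ?case
  proof (cases "nested (a, b, c)")
    case True
    have fin: "finite (?P i)" for i
      using Suc.IH by (cases i) auto
    have ext: "p (Suc n) = undefined" if "p \<in> ?P i" for p i
      using that by (cases i) (auto simp: triple_paths_def extensional_def)
    have inj: "inj_on ?ext (\<Union>i. ?P i)"
    proof (rule inj_onI)
      fix p p' assume "p \<in> (\<Union>i. ?P i)" "p' \<in> (\<Union>i. ?P i)" and eq: "?ext p = ?ext p'"
      then obtain i i' where "p \<in> ?P i" "p' \<in> ?P i'" by blast
      then have "p (Suc n) = p' (Suc n)" using ext by metis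
      then show "p = p'" using eq by (metis fun_upd_triv fun_upd_upd)
    qed
    have disj: "?P i \<inter> ?P i' = {}" if "i \<noteq> i'" for i i'
      using that by (cases i; cases i') (auto simp: triple_paths_def)
    have U: "triple_paths (Suc n) (a, b, c) = (\<Union>i\<in>?I. ?ext ` ?P i)"
      using True by (simp only: triple_paths_Suc if_True split_def)
    have "card (\<Union>i\<in>?I. ?ext ` ?P i) = (\<Sum>i\<in>?I. card (?ext ` ?P i))"
    proof (rule card_UN_disjoint)
      show "\<forall>i\<in>?I. \<forall>i'\<in>?I. i \<noteq> i' \<longrightarrow> ?ext ` ?P i \<inter> ?ext ` ?P i' = {}"
      proof (intro ballI impI)
        fix i i' :: "int \<times> int \<times> int" assume "i \<noteq> i'"
        have "?ext ` (?P i \<inter> ?P i') = ?ext ` ?P i \<inter> ?ext ` ?P i'"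
          by (rule inj_on_image_Int[OF inj]) blast+
        then show "?ext ` ?P i \<inter> ?ext ` ?P i' = {}"
          unfolding disj[OF \<open>i \<noteq> i'\<close>] by simp
      qed
    qed (use fin in auto)
    also have "\<dots> = (\<Sum>i\<in>?I. card (?P i))"
      by (intro sum.cong refl card_image inj_on_subset[OF inj]) auto
    finally have "int (card (triple_paths (Suc n) (a, b, c))) = (\<Sum>i\<in>?I. int (card (?P i)))"
      unfolding U by simp
    also have "\<dots> = path_count (Suc n) a b c"
      using True Suc.IH unfolding path_count_def path_sum.simps nested_def
      by (auto simp: split_def simp del: sum.insert intro!: sum.cong)
    moreover have "finite (triple_paths (Suc n) (a, b, c))"
      unfolding U by (intro finite_UN_I finite_imageI fin) simp
    ultimately show ?thesis by simp
  next
    case False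
    then show ?thesis
      unfolding triple_paths_Suc by (auto simp: path_count_def nested_def)
  qed
qed

section \<open>Folding a self-complementary plane partition\<close>

definition level_set :: "nat \<Rightarrow> nat \<Rightarrow> (nat \<times> nat \<Rightarrow> nat) \<Rightarrow> nat \<Rightarrow> (nat \<times> nat) set" where
  "level_set k l \<pi> r = {c \<in> {1..k} \<times> {1..l}. r \<le> \<pi> c}"

definition self_complementary :: "nat \<Rightarrow> nat \<Rightarrow> (nat \<times> nat \<Rightarrow> nat) set" where
  "self_complementary k l = {\<pi> \<in> plane_partitions k l 3. pp_complement k l 3 \<pi> = \<pi>}"

text \<open>The level set of 3 is the smallest diagram, so its boundary is the highest of the three paths.\<close>

definition half_boundaries :: "nat \<Rightarrow> nat \<Rightarrow> (nat \<times> nat \<Rightarrow> nat) \<Rightarrow> nat \<Rightarrow> int \<times> int \<times> int" where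
  "half_boundaries k l \<pi> = (\<lambda>t\<in>{..(k + l) div 2}.
     (boundary k l (level_set k l \<pi> 3) t, boundary k l (level_set k l \<pi> 2) t,
      boundary k l (level_set k l \<pi> 1) t))"

text \<open>The end points from which three half paths continue to their mirror images. The mirror image of the
lowest path continues the highest one, and conversely, while the middle path continues its own.
The two differences are the heights gained in the middle: nothing can be gained if \<open>k + l\<close> is
even, and at most one step if it is odd.\<close>

definition foldable_ends :: "nat \<Rightarrow> nat \<Rightarrow> (int \<times> int \<times> int) set" where
  "foldable_ends k l = {(x, y, z). z \<le> y \<and> y \<le> x \<and>
     int k - 2 * y \<in> {0..int ((k + l) mod 2)} \<and> int k - x - z \<in> {0..int ((k + l) mod 2)}}"

lemma diagram_level_set:
  assumes "\<pi> \<in> plane_partitions k l m" "1 \<le> r"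
  shows "diagram k l (level_set k l \<pi> r)"
  unfolding diagram_def
proof (intro conjI allI impI)
  fix i j i' j'
  assume A: "(i, j) \<in> level_set k l \<pi> r" "1 \<le> i'" "i' \<le> i" "1 \<le> j'" "j' \<le> j"
  then have ij: "i \<in> {1..k}" "j \<in> {1..l}" "i' \<in> {1..k}" "j' \<in> {1..l}"
    by (auto simp: level_set_def)
  have "\<pi> (i, j) \<le> \<pi> (i, j')" "\<pi> (i, j') \<le> \<pi> (i', j')"
    using assms(1) ij A(3,5) unfolding plane_partitions_def by blast+
  then show "(i', j') \<in> level_set k l \<pi> r"
    using A ij by (auto simp: level_set_def)
qed (auto simp: level_set_def)

lemma level_set_complement:
  assumes "\<pi> \<in> self_complementary k l" "r \<in> {1, 2, 3}"
  shows "level_set k l \<pi> r = complementary_cells k l (level_set k l \<pi> (4 - r))"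
proof -
  have "\<pi> (i, j) = 3 - \<pi> (k + 1 - i, l + 1 - j) \<and> \<pi> (i, j) \<le> 3"
    if "i \<in> {1..k}" "j \<in> {1..l}" for i j
  proof -
    have "pp_complement k l 3 \<pi> (i, j) = \<pi> (i, j)"
      using assms by (simp add: self_complementary_def)
    then show ?thesis using that by (simp add: pp_complement_def)
  qed
  then have "r \<le> \<pi> (i, j) \<longleftrightarrow> \<not> 4 - r \<le> \<pi> (k + 1 - i, l + 1 - j)"
    if "i \<in> {1..k}" "j \<in> {1..l}" for i j
    using that assms(2) by fastforce
  then show ?thesis
    unfolding level_set_def complementary_cells_def by fastforce
qed

lemma plane_partition_eqI:
  assumes "\<pi> \<in> plane_partitions k l 3" "\<rho> \<in> plane_partitions k l 3"
    and "\<And>r. r \<in> {1, 2, 3} \<Longrightarrow> level_set k l \<pi> r = level_set k l \<rho> r"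
  shows "\<pi> = \<rho>"
proof (rule PiE_ext)
  show PiE: "\<pi> \<in> {1..k} \<times> {1..l} \<rightarrow>\<^sub>E {0..3}" "\<rho> \<in> {1..k} \<times> {1..l} \<rightarrow>\<^sub>E {0..3}"
    using assms by (auto simp: plane_partitions_def)
  fix c assume c: "c \<in> {1..k} \<times> {1..l}"
  have "\<pi> c \<in> {0..3}" "\<rho> c \<in> {0..3}"
    by (fact PiE[THEN PiE_mem, OF c])+
  moreover have "r \<le> \<pi> c \<longleftrightarrow> r \<le> \<rho> c" if "r \<in> {1, 2, 3}" for r
    using assms(3)[OF that] c unfolding level_set_def by blast
  from this[of 1] this[of 2] this[of 3] have "1 \<le> \<pi> c \<longleftrightarrow> 1 \<le> \<rho> c" "2 \<le> \<pi> c \<longleftrightarrow> 2 \<le> \<rho> c" "3 \<le> \<pi> c \<longleftrightarrow> 3 \<le> \<rho> c"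
    by auto
  ultimately show "\<pi> c = \<rho> c"
    unfolding atLeastAtMost_iff by linarith
qed

lemma half_boundaries_in_triple_paths:
  assumes \<pi>: "\<pi> \<in> self_complementary k l"
  shows "half_boundaries k l \<pi> \<in> (\<Union>v\<in>foldable_ends k l. triple_paths ((k + l) div 2) v)"
proof -
  let ?b = "\<lambda>r. boundary k l (level_set k l \<pi> r)" and ?m = "(k + l) div 2"
  have pp: "\<pi> \<in> plane_partitions k l 3" using \<pi> by (simp add: self_complementary_def)
  have path: "lattice_path k l (?b r)" if "1 \<le> r" for r
    by (intro lattice_path_boundary diagram_level_set[OF pp that])
  have nest: "?b r t \<le> ?b s t" if "r \<le> s" for r s t
    using that by (intro boundary_antimono) (auto simp: level_set_def)
  have mid: "?m + (k + l) mod 2 \<le> k + l" "k + l - (?m + (k + l) mod 2) = ?m"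
    by presburger+
  have refl: "?b r (?m + (k + l) mod 2) = int k - ?b (4 - r) ?m" if "r \<in> {1, 2, 3}" for r
  proof -
    have "1 \<le> 4 - r" using that by auto
    then show ?thesis
      unfolding level_set_complement[OF \<pi> that]
      by (simp only: boundary_complementary_cells[OF diagram_level_set[OF pp] mid(1)] mid(2))
  qed
  have "(?b 3 ?m, ?b 2 ?m, ?b 1 ?m) \<in> foldable_ends k l"
    using nest[of 2 3 ?m] nest[of 1 2 ?m] refl[of 2] refl[of 3]
      lattice_path_increment[OF path[of 2] mid(1)] lattice_path_increment[OF path[of 3] mid(1)]
    by (simp add: foldable_ends_def)
  moreover have "half_boundaries k l \<pi> \<in> triple_paths ?m (?b 3 ?m, ?b 2 ?m, ?b 1 ?m)"
  proof -
    have "?b r 0 = 0" if "1 \<le> r" for r using path[OF that] by (simp add: lattice_path_def)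
    moreover have "?b r (Suc t) - ?b r t \<in> {0, 1}" if "1 \<le> r" "t < ?m" for r t
    proof -
      have "t < k + l" using that by presburger
      then have "?b r t \<le> ?b r (Suc t) \<and> ?b r (Suc t) \<le> ?b r t + 1"
        using path[OF that(1)] unfolding lattice_path_def by blast
      then show ?thesis by auto
    qed
    ultimately show ?thesis
      using nest by (simp add: triple_paths_def half_boundaries_def nested_def unit_step_def)
  qed
  ultimately show ?thesis by blast
qed

text \<open>The second half of each boundary is the mirror image of the first half of the opposite one, so
half of the data determines the boundaries, hence the level sets, hence the plane partition.\<close>

lemma inj_on_half_boundaries: "inj_on (half_boundaries k l) (self_complementary k l)"
proof (rule inj_onI)
  fix \<pi> \<rho> assume \<pi>: "\<pi> \<in> self_complementary k l" and \<rho>: "\<rho> \<in> self_complementary k l"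
    and eq: "half_boundaries k l \<pi> = half_boundaries k l \<rho>"
  have pp: "\<pi> \<in> plane_partitions k l 3" "\<rho> \<in> plane_partitions k l 3"
    using \<pi> \<rho> by (simp_all add: self_complementary_def)
  have half: "boundary k l (level_set k l \<pi> r) t = boundary k l (level_set k l \<rho> r) t"
    if "r \<in> {1, 2, 3}" "t \<le> (k + l) div 2" for r t
    using fun_cong[OF eq, of t] that by (auto simp: half_boundaries_def)
  have full: "boundary k l (level_set k l \<pi> r) t = boundary k l (level_set k l \<rho> r) t"
    if r: "r \<in> {1, 2, 3}" and t: "t \<le> k + l" for r t
  proof (cases "t \<le> (k + l) div 2")
    case False
    have r': "1 \<le> 4 - r" "4 - r \<in> {1, 2, 3}" using r by auto
    have "k + l - t \<le> (k + l) div 2" using False by presburger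
    from half[OF r'(2) this] show ?thesis
      unfolding level_set_complement[OF \<pi> r] level_set_complement[OF \<rho> r]
      by (simp add: boundary_complementary_cells diagram_level_set[OF pp(1) r'(1)]
          diagram_level_set[OF pp(2) r'(1)] t)
  qed (rule half[OF r])
  have "level_set k l \<pi> r = level_set k l \<rho> r" if r: "r \<in> {1, 2, 3}" for r
  proof -
    have "cells_above k l (boundary k l (level_set k l \<pi> r)) =
        cells_above k l (boundary k l (level_set k l \<rho> r))"
      by (auto simp: cells_above_def full[OF r])
    then show ?thesis
      using r by (subst (asm) (1 2) cells_above_boundary)
        (auto intro: diagram_level_set[OF pp(1)] diagram_level_set[OF pp(2)])
  qed
  then show "\<pi> = \<rho>" by (rule plane_partition_eqI[OF pp])
qed

text \<open>The half path \<open>u\<close> continued by the mirror image of the half path \<open>v\<close>.\<close>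

definition unfold_path :: "nat \<Rightarrow> nat \<Rightarrow> (nat \<Rightarrow> int) \<Rightarrow> (nat \<Rightarrow> int) \<Rightarrow> nat \<Rightarrow> int" where
  "unfold_path k l u v t = (if t \<le> (k + l) div 2 then u t else int k - v (k + l - t))"

lemma lattice_path_unfold_path:
  assumes zero: "u 0 = 0" "v 0 = 0"
    and u: "\<And>t. t < (k + l) div 2 \<Longrightarrow> u (Suc t) - u t \<in> {0, 1}"
    and v: "\<And>t. t < (k + l) div 2 \<Longrightarrow> v (Suc t) - v t \<in> {0, 1}"
    and mid: "int k - u ((k + l) div 2) - v ((k + l) div 2) \<in> {0..int ((k + l) mod 2)}"
  shows "lattice_path k l (unfold_path k l u v)"
proof -
  let ?m = "(k + l) div 2" and ?h = "unfold_path k l u v"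
  have "?h t \<le> ?h (Suc t) \<and> ?h (Suc t) \<le> ?h t + 1" if t: "t < k + l" for t
  proof -
    consider "t < ?m" | "t = ?m" "k + l = 2 * ?m" | "t = ?m" "k + l = 2 * ?m + 1" | "?m < t"
      by linarith
    then show ?thesis
    proof cases
      case 1
      then show ?thesis using u[of t] by (auto simp: unfold_path_def)
    next
      case 2
      then have "k + l - Suc t < ?m" "Suc (k + l - Suc t) = ?m" "(k + l) mod 2 = 0"
        using t by presburger+
      then show ?thesis using 2 v[of "k + l - Suc t"] mid by (auto simp: unfold_path_def)
    next
      case 3
      then have "k + l - Suc t = ?m" "(k + l) mod 2 = 1"
        by presburger+
      then show ?thesis using 3 mid by (auto simp: unfold_path_def)
    next
      case 4
      then have "k + l - Suc t < ?m" "Suc (k + l - Suc t) = k + l - t"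
        using t by presburger+
      then show ?thesis using 4 v[of "k + l - Suc t"] by (auto simp: unfold_path_def)
    qed
  qed
  moreover have "?h (k + l) = int k"
    using zero by (cases "k + l") (auto simp: unfold_path_def)
  ultimately show ?thesis
    using zero by (auto simp: lattice_path_def unfold_path_def)
qed

lemma unfold_path_reverse:
  assumes mid: "int k - u ((k + l) div 2) - v ((k + l) div 2) \<in> {0..int ((k + l) mod 2)}"
    and t: "t \<le> k + l"
  shows "unfold_path k l u v t = int k - unfold_path k l v u (k + l - t)"
proof -
  let ?m = "(k + l) div 2"
  have "t \<le> ?m \<and> ?m < k + l - t \<or> t = ?m \<and> k + l - t = ?m \<and> (k + l) mod 2 = 0 \<or>
      ?m < t \<and> k + l - t \<le> ?m"
    using t by presburger
  then show ?thesis
  proof (elim disjE conjE)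
    assume "t = ?m" "k + l - t = ?m" "(k + l) mod 2 = 0"
    then show ?thesis using mid by (simp add: unfold_path_def)
  qed (simp_all add: unfold_path_def t)
qed

text \<open>The plane partition with the level sets \<open>C \<subseteq> B \<subseteq> A\<close>.\<close>

definition stack :: "nat \<Rightarrow> nat \<Rightarrow> (nat \<times> nat) set \<Rightarrow> (nat \<times> nat) set \<Rightarrow> (nat \<times> nat) set \<Rightarrow> nat \<times> nat \<Rightarrow> nat" where
  "stack k l A B C = (\<lambda>c\<in>{1..k} \<times> {1..l}. of_bool (c \<in> A) + of_bool (c \<in> B) + of_bool (c \<in> C))"

lemma level_set_stack:
  assumes "A \<subseteq> {1..k} \<times> {1..l}" "B \<subseteq> A" "C \<subseteq> B"
  shows "level_set k l (stack k l A B C) 1 = A" "level_set k l (stack k l A B C) 2 = B"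
    "level_set k l (stack k l A B C) 3 = C"
  using assms by (auto simp: level_set_def stack_def of_bool_def split: if_splits)

lemma stack_in_plane_partitions:
  assumes "diagram k l A" "diagram k l B" "diagram k l C"
  shows "stack k l A B C \<in> plane_partitions k l 3"
proof -
  have "of_bool ((i', j') \<in> D) \<le> (of_bool ((i, j) \<in> D) :: nat)"
    if "diagram k l D" "1 \<le> i" "i \<le> i'" "1 \<le> j" "j \<le> j'" for i j i' j' D
    using that unfolding diagram_def by (auto simp: of_bool_def)
  then have "stack k l A B C (i', j') \<le> stack k l A B C (i, j)"
    if "i \<in> {1..k}" "i' \<in> {1..k}" "j \<in> {1..l}" "j' \<in> {1..l}" "i \<le> i'" "j \<le> j'" for i j i' j'
    using that assms unfolding stack_def by (auto intro!: add_mono)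
  then show ?thesis
    unfolding plane_partitions_def by (auto simp: stack_def of_bool_def)
qed

lemma stack_self_complementary:
  assumes "diagram k l A" "diagram k l B" "diagram k l C"
    and "C = complementary_cells k l A" "B = complementary_cells k l B"
      "A = complementary_cells k l C"
  shows "stack k l A B C \<in> self_complementary k l"
proof -
  have "pp_complement k l 3 (stack k l A B C) (i, j) = stack k l A B C (i, j)" for i j
  proof (cases "(i, j) \<in> {1..k} \<times> {1..l}")
    case True
    let ?c = "(k + 1 - i, l + 1 - j)"
    have "(i, j) \<in> C \<longleftrightarrow> ?c \<notin> A" "(i, j) \<in> B \<longleftrightarrow> ?c \<notin> B" "(i, j) \<in> A \<longleftrightarrow> ?c \<notin> C"
      using True assms(4-6) unfolding complementary_cells_def by blast+
    then show ?thesis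
      using True by (auto simp: pp_complement_def stack_def)
  next
    case False
    then show ?thesis
      unfolding pp_complement_def stack_def restrict_def by (simp only: if_False)
  qed
  then have "pp_complement k l 3 (stack k l A B C) = stack k l A B C" by auto
  then show ?thesis
    using stack_in_plane_partitions[OF assms(1-3)] by (simp add: self_complementary_def)
qed

text \<open>Unfolding the half paths gives three nested lattice paths that are mirror images of each other in
the required way; the diagrams above them stack up to a self-complementary plane partition.\<close>

lemma half_boundaries_surj:
  assumes "f \<in> triple_paths ((k + l) div 2) v" "v \<in> foldable_ends k l"
  shows "f \<in> half_boundaries k l ` self_complementary k l"
proof -
  let ?m = "(k + l) div 2"
  define x y z where "x t = fst (f t)" "y t = fst (snd (f t))" "z t = snd (snd (f t))" for t
  have f: "f t = (x t, y t, z t)" for t by (simp add: x_y_z_def)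
  have zero: "x 0 = 0" "y 0 = 0" "z 0 = 0"
    using assms(1) by (simp_all add: triple_paths_def f)
  have steps: "x (Suc t) - x t \<in> {0, 1}" "y (Suc t) - y t \<in> {0, 1}" "z (Suc t) - z t \<in> {0, 1}"
    if "t < ?m" for t
    using assms(1) that by (simp_all add: triple_paths_def f unit_step_def)
  have nest: "z t \<le> y t" "y t \<le> x t" if "t \<le> ?m" for t
    using assms(1) that by (simp_all add: triple_paths_def f nested_def)
  have "(x ?m, y ?m, z ?m) \<in> foldable_ends k l"
    using assms by (simp add: triple_paths_def f)
  then have mid: "int k - y ?m - y ?m \<in> {0..int ((k + l) mod 2)}"
    "int k - x ?m - z ?m \<in> {0..int ((k + l) mod 2)}" "int k - z ?m - x ?m \<in> {0..int ((k + l) mod 2)}"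
    by (auto simp: foldable_ends_def)
  let ?X = "unfold_path k l x z" and ?Y = "unfold_path k l y y" and ?Z = "unfold_path k l z x"
  let ?A = "cells_above k l ?Z" and ?B = "cells_above k l ?Y" and ?C = "cells_above k l ?X"
  have paths: "lattice_path k l ?X" "lattice_path k l ?Y" "lattice_path k l ?Z"
    by (intro lattice_path_unfold_path zero steps mid; assumption)+
  note dgs = paths[THEN diagram_cells_above]
  have mono: "cells_above k l h \<subseteq> cells_above k l h'" if "\<And>t. t \<le> k + l \<Longrightarrow> h' t \<le> h t" for h h'
  proof -
    have "h' (k + j - i) + int i \<le> int k" if "j \<le> l" "h (k + j - i) + int i \<le> int k" for i j
      using \<open>\<And>t. t \<le> k + l \<Longrightarrow> h' t \<le> h t\<close>[of "k + j - i"] that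
      by fastforce
    then show ?thesis by (auto simp: cells_above_def)
  qed
  have sub: "?B \<subseteq> ?A" "?C \<subseteq> ?B"
    using nest by (auto intro!: mono simp: unfold_path_def)
  have rev: "cells_above k l (unfold_path k l u w) = complementary_cells k l (cells_above k l (unfold_path k l w u))"
    if "int k - u ?m - w ?m \<in> {0..int ((k + l) mod 2)}" for u w
    unfolding cells_above_reverse[symmetric]
    by (intro equalityI mono) (simp_all add: unfold_path_reverse[where u = u and v = w, OF that])
  have "stack k l ?A ?B ?C \<in> self_complementary k l"
    by (rule stack_self_complementary) (intro dgs rev mid)+
  moreover have "half_boundaries k l (stack k l ?A ?B ?C) = f"
  proof
    fix t
    have "?A \<subseteq> {1..k} \<times> {1..l}" using dgs(3) by (simp add: diagram_def)
    note levels = level_set_stack[OF this sub]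
    have undefined: "f t = undefined" if "\<not> t \<le> ?m"
      using assms(1) that by (simp add: triple_paths_def extensional_def)
    show "half_boundaries k l (stack k l ?A ?B ?C) t = f t"
    proof (cases "t \<le> ?m")
      case True
      then have t: "t \<le> k + l" by presburger
      show ?thesis
        unfolding half_boundaries_def levels
        using True t by (simp add: paths[THEN boundary_cells_above] unfold_path_def f)
    qed (simp add: half_boundaries_def undefined)
  qed
  ultimately show ?thesis by blast
qed

section \<open>Comparison of the two counts\<close>

text \<open>No path is higher than its number of steps. In the product formula this shows in the factor
\<open>1 / (n - x)!\<close>.\<close>

lemma triple_paths_eq_empty:
  assumes "int n < x"
  shows "triple_paths n (x, y, z) = {}"
proof -
  have "path_count n x y z = 0"
  proof (cases "z \<le> y \<and> y \<le> x")
    case True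
    then have "of_int (path_count n x y z) = (0 :: rat)"
      using assms by (simp add: path_count_closed_form at_one.ifact_def)
    then show ?thesis by simp
  next
    case False
    then show ?thesis by (cases n) (auto simp: path_count_def)
  qed
  then show ?thesis
    using card_triple_paths[of n x y z] by auto
qed

lemma card_triple_paths_family:
  fixes x z :: "nat \<Rightarrow> int"
  assumes "inj x" and "\<And>s. n < s \<Longrightarrow> int n < x s"
  shows "finite (\<Union>s. triple_paths n (x s, y, z s))"
    and "int (card (\<Union>s. triple_paths n (x s, y, z s))) = (\<Sum>s\<le>n. path_count n (x s) y (z s))"
proof -
  have U: "(\<Union>s. triple_paths n (x s, y, z s)) = (\<Union>s\<in>{..n}. triple_paths n (x s, y, z s))"
  proof -
    have "triple_paths n (x s, y, z s) = {}" if "s \<notin> {..n}" for s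
      using that assms(2)[of s] by (simp add: triple_paths_eq_empty)
    then show ?thesis by blast
  qed
  show "finite (\<Union>s. triple_paths n (x s, y, z s))"
    unfolding U using card_triple_paths by blast
  have "card (\<Union>s\<in>{..n}. triple_paths n (x s, y, z s)) = (\<Sum>s\<le>n. card (triple_paths n (x s, y, z s)))"
  proof (rule card_UN_disjoint)
    have "x i \<noteq> x j" if "i \<noteq> j" for i j using assms(1) that by (simp add: inj_eq)
    then show "\<forall>i\<in>{..n}. \<forall>j\<in>{..n}. i \<noteq> j \<longrightarrow>
        triple_paths n (x i, y, z i) \<inter> triple_paths n (x j, y, z j) = {}"
      by (fastforce simp: triple_paths_def)
  qed (use card_triple_paths in auto)
  then show "int (card (\<Union>s. triple_paths n (x s, y, z s))) = (\<Sum>s\<le>n. path_count n (x s) y (z s))"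
    unfolding U using card_triple_paths by simp
qed

lemma foldable_ends_even_even:
  "foldable_ends (2 * a) (2 * b) = range (\<lambda>s. (int a + int s, int a, int a - int s))"
proof -
  have "(x, y, z) \<in> range (\<lambda>s. (int a + int s, int a, int a - int s))"
    if "(x, y, z) \<in> foldable_ends (2 * a) (2 * b)" for x y z
    using that by (intro image_eqI[of _ _ "nat (x - y)"]) (auto simp: foldable_ends_def)
  then show ?thesis by (auto simp: foldable_ends_def)
qed

lemma foldable_ends_even_odd:
  "foldable_ends (2 * a) (2 * b + 1) = range (\<lambda>s. (int a + int s, int a, int a - int s)) \<union>
    range (\<lambda>s. (int a + int s, int a, int a - int s - 1))"
proof -
  have m: "(2 * a + (2 * b + 1)) mod 2 = 1" by presburger
  have "(x, y, z) \<in> range (\<lambda>s. (int a + int s, int a, int a - int s)) \<union>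
    range (\<lambda>s. (int a + int s, int a, int a - int s - 1))"
    if v: "(x, y, z) \<in> foldable_ends (2 * a) (2 * b + 1)" for x y z
  proof -
    have "y = int a" "x = int a + int (nat (x - y))" "z = 2 * int a - x \<or> z = 2 * int a - x - 1"
      using v unfolding foldable_ends_def m by auto
    then show ?thesis by (auto intro: range_eqI[of _ _ "nat (x - y)"])
  qed
  then show ?thesis unfolding foldable_ends_def m by auto
qed

lemma foldable_ends_odd_even:
  "foldable_ends (2 * a + 1) (2 * b) = range (\<lambda>s. (int a + int s, int a, int a - int s)) \<union>
    range (\<lambda>s. (int a + int s + 1, int a, int a - int s))"
proof -
  have m: "(2 * a + 1 + 2 * b) mod 2 = 1" by presburger
  have "(x, y, z) \<in> range (\<lambda>s. (int a + int s, int a, int a - int s)) \<union>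
    range (\<lambda>s. (int a + int s + 1, int a, int a - int s))"
    if v: "(x, y, z) \<in> foldable_ends (2 * a + 1) (2 * b)" for x y z
  proof -
    have "y = int a" "z = int a - int (nat (y - z))" "x = 2 * int a - z \<or> x = 2 * int a - z + 1"
      using v unfolding foldable_ends_def m by auto
    then show ?thesis by (auto intro: range_eqI[of _ _ "nat (y - z)"])
  qed
  then show ?thesis unfolding foldable_ends_def m by auto
qed

text \<open>The middle path would have to be at height \<open>k / 2\<close> at half time.\<close>

lemma foldable_ends_odd_odd: "foldable_ends (2 * a + 1) (2 * b + 1) = {}"
proof -
  have m: "(2 * a + 1 + (2 * b + 1)) mod 2 = 0" by presburger
  show ?thesis unfolding foldable_ends_def m by auto presburger
qed

lemma baxter_Theta_fixed_eq:
  "baxter_Theta_fixed k l = card (\<Union>v\<in>foldable_ends k l. triple_paths ((k + l) div 2) v)"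
proof -
  have "half_boundaries k l ` self_complementary k l =
      (\<Union>v\<in>foldable_ends k l. triple_paths ((k + l) div 2) v)"
    using half_boundaries_in_triple_paths half_boundaries_surj by blast
  then have "card (self_complementary k l) = card (\<Union>v\<in>foldable_ends k l. triple_paths ((k + l) div 2) v)"
    using card_image[OF inj_on_half_boundaries, of k l] by simp
  then show ?thesis by (simp add: baxter_Theta_fixed_def self_complementary_def)
qed

lemma baxter_Theta_fixed_even_even:
  "int (baxter_Theta_fixed (2 * a) (2 * b)) =
     (\<Sum>s\<le>a + b. path_count (a + b) (int a + int s) (int a) (int a - int s))"
proof -
  have m: "(2 * a + 2 * b) div 2 = a + b" by simp
  show ?thesis
    unfolding baxter_Theta_fixed_eq foldable_ends_even_even m UN_simps image_image
    by (subst card_triple_paths_family(2)) (auto simp: inj_def)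
qed

text \<open>The sum of the outer heights tells the two families apart.\<close>

lemma card_two_triple_paths_families:
  fixes x z x' z' :: "nat \<Rightarrow> int"
  assumes "inj x" "\<And>s. n < s \<Longrightarrow> int n < x s" "inj x'" "\<And>s. n < s \<Longrightarrow> int n < x' s"
    and "\<And>s s'. x s + z s \<noteq> x' s' + z' s'"
  shows "int (card (\<Union>v\<in>range (\<lambda>s. (x s, y, z s)) \<union> range (\<lambda>s. (x' s, y, z' s)). triple_paths n v)) =
    (\<Sum>s\<le>n. path_count n (x s) y (z s)) + (\<Sum>s\<le>n. path_count n (x' s) y (z' s))"
proof -
  have U: "(\<Union>v\<in>range (\<lambda>s. (x s, y, z s)) \<union> range (\<lambda>s. (x' s, y, z' s)). triple_paths n v) =
    (\<Union>s. triple_paths n (x s, y, z s)) \<union> (\<Union>s. triple_paths n (x' s, y, z' s))" by auto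
  have "(\<Union>s. triple_paths n (x s, y, z s)) \<inter> (\<Union>s. triple_paths n (x' s, y, z' s)) = {}"
    using assms(5) by (auto simp: triple_paths_def) metis
  then show ?thesis
    unfolding U using assms(1-4)
    by (simp add: card_Un_disjoint card_triple_paths_family)
qed

lemma baxter_Theta_fixed_even_odd:
  "int (baxter_Theta_fixed (2 * a) (2 * b + 1)) =
     (\<Sum>s\<le>a + b. path_count (a + b) (int a + int s) (int a) (int a - int s)) +
     (\<Sum>s\<le>a + b. path_count (a + b) (int a + int s) (int a) (int a - int s - 1))"
proof -
  have m: "(2 * a + (2 * b + 1)) div 2 = a + b" by simp
  show ?thesis
    unfolding baxter_Theta_fixed_eq foldable_ends_even_odd m
    by (rule card_two_triple_paths_families) (auto simp: inj_def)
qed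

lemma baxter_Theta_fixed_odd_even:
  "int (baxter_Theta_fixed (2 * a + 1) (2 * b)) =
     (\<Sum>s\<le>a + b. path_count (a + b) (int a + int s) (int a) (int a - int s)) +
     (\<Sum>s\<le>a + b. path_count (a + b) (int a + int s + 1) (int a) (int a - int s))"
proof -
  have m: "(2 * a + 1 + 2 * b) div 2 = a + b" by simp
  show ?thesis
    unfolding baxter_Theta_fixed_eq foldable_ends_odd_even m
    by (rule card_two_triple_paths_families) (auto simp: inj_def)
qed

lemma baxter_Theta_fixed_odd_odd: "baxter_Theta_fixed (2 * a + 1) (2 * b + 1) = 0"
  unfolding baxter_Theta_fixed_eq foldable_ends_odd_odd by simp

lemma int_eqI_of_rat:
  fixes p c d r :: int
  assumes "p * d = r" "d \<noteq> 0" "of_int c = (of_int r / of_int d :: rat)"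
  shows "p = c"
proof -
  have "of_int c * of_int d = (of_int (p * d) :: rat)"
    using assms by simp
  then show ?thesis using assms(2) by simp
qed

text \<open>The total of the two families of end points for odd \<open>k + l\<close>, with \<open>F = (a+b)!\<close>, \<open>G = (a+b+1)!\<close>,
and \<open>P\<close>, \<open>U\<close> and \<open>Q\<close>, \<open>V\<close> two pairs of consecutive factorials.\<close>

lemma add_fractions_identity:
  fixes F G U V P Q x y :: "'a::field"
  assumes "G = (x + y + 1) * F" "V = (y + 1) * Q" "U \<noteq> 0" "V \<noteq> 0" "P \<noteq> 0" "Q \<noteq> 0"
  shows "F ^ 2 * G / (U * V) * (1 / (P ^ 2 * Q ^ 2)) + F ^ 2 * G / (U * V) * (x / (P ^ 2 * Q * V)) =
    F * G ^ 2 / (P ^ 2 * U * (Q * V ^ 2))"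
proof -
  have "1 / Q = (y + 1) / V"
    using assms(2,4,6) by simp
  then have "1 / Q + x / V = (x + y + 1) / V"
    by (simp add: add_ac flip: add_divide_distrib)
  moreover have "F ^ 2 * G / (U * V) * (1 / (P ^ 2 * Q ^ 2)) + F ^ 2 * G / (U * V) * (x / (P ^ 2 * Q * V)) =
      F ^ 2 * G / (U * V * P ^ 2 * Q) * (1 / Q + x / V)"
    by (simp add: distrib_left add_divide_distrib power2_eq_square mult_ac)
  moreover have "F ^ 2 * G * (x + y + 1) = F * G ^ 2"
    unfolding assms(1) by (simp add: power2_eq_square mult_ac)
  ultimately show ?thesis
    by (simp add: power2_eq_square mult_ac)
qed

lemma theta_poly_at_minus_1_eq_card:
  "poly (theta_poly k l) (-1) = int (baxter_Theta_fixed k l)"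
proof -
  obtain a b where "k = 2 * a \<or> k = 2 * a + 1" "l = 2 * b \<or> l = 2 * b + 1"
    by (meson oddE evenE)
  then consider "k = 2 * a" "l = 2 * b" | "k = 2 * a" "l = 2 * b + 1"
    | "k = 2 * a + 1" "l = 2 * b" | "k = 2 * a + 1" "l = 2 * b + 1" by blast
  then show ?thesis
  proof cases
    case 1
    have "of_int (int (baxter_Theta_fixed k l)) =
        (of_int (fact (a + b) ^ 2 * fact (a + b + 1)) /
         of_int (fact a ^ 2 * fact (a + 1) * (fact b ^ 2 * fact (b + 1))) :: rat)"
      unfolding 1 baxter_Theta_fixed_even_even of_int_sum sum_path_count_centred
      by (simp only: of_int_mult of_int_power of_int_fact times_divide_times_eq mult_1_right mult_ac)
    from int_eqI_of_rat[OF theta_poly_at_minus_1(1) _ this] show ?thesis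
      unfolding 1 by simp
  next
    case 2
    have G: "fact (a + b + 1) = (of_nat a + of_nat b + 1) * (fact (a + b) :: rat)"
      and V: "fact (b + 1) = (of_nat b + 1) * (fact b :: rat)"
      by (simp_all add: algebra_simps)
    have "of_int (int (baxter_Theta_fixed k l)) =
        (of_int (fact (a + b) * fact (a + b + 1) ^ 2) /
         of_int (fact a ^ 2 * fact (a + 1) * (fact b * fact (b + 1) ^ 2)) :: rat)"
      unfolding 2 baxter_Theta_fixed_even_odd of_int_add of_int_sum sum_path_count_centred
        sum_path_count_low add_fractions_identity[OF G V fact_nonzero fact_nonzero fact_nonzero fact_nonzero]
      by (simp only: of_int_mult of_int_power of_int_fact)
    from int_eqI_of_rat[OF theta_poly_at_minus_1(2) _ this] show ?thesis
      unfolding 2 by simp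
  next
    case 3
    have G: "fact (a + b + 1) = (of_nat b + of_nat a + 1) * (fact (a + b) :: rat)"
      and V: "fact (a + 1) = (of_nat a + 1) * (fact a :: rat)"
      by (simp_all add: algebra_simps)
    have "of_int (int (baxter_Theta_fixed k l)) =
        (of_int (fact (a + b) * fact (a + b + 1) ^ 2) /
         of_int (fact a * fact (a + 1) ^ 2 * (fact b ^ 2 * fact (b + 1))) :: rat)"
      using add_fractions_identity[OF G V, of "fact (b + 1)" "fact b"]
      unfolding 3 baxter_Theta_fixed_odd_even of_int_add of_int_sum sum_path_count_centred
        sum_path_count_high
      by (simp only: mult_ac of_int_mult of_int_power of_int_fact fact_nonzero not_False_eq_True
          simp_thms)
    from int_eqI_of_rat[OF theta_poly_at_minus_1(3) _ this] show ?thesis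
      unfolding 3 by simp
  next
    case 4
    then show ?thesis
      using theta_poly_at_minus_1(4)[of a b] baxter_Theta_fixed_odd_odd[of a b] by simp
  qed
qed

theorem theorem1p2:
  fixes k l :: nat
  shows "\<exists>p :: int poly.
           to_fract p = baxter_Theta k l \<and>
           (\<forall>j. coeff p j \<ge> 0) \<and>
           symmetric_coeffs p \<and>
           poly p (- 1) = int (baxter_Theta_fixed k l)"
  using to_fract_theta_poly theta_poly_symmetric theta_poly_at_minus_1_eq_card
    path_sum_coeff_nonneg[folded theta_poly_def]
  unfolding theta_poly_def by blast

end
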